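(* Let $H(z)=p_n(z)+\overline{q_n(z)}$ be sampled from the harmonic Kac ensemble with $m=n$. Then, as $n\to\infty$, $$\mathbb{E}\,N_H\big(\{z: |z|^2\le 1+\tfrac{(\log n)^2}{n}\}\big)=O(n\log\log n),$$ $$\mathbb{E}\,N_H\big(\{z: 1+\tfrac{(\log n)^2}{n}\le |z|^2\le 1+(\log n)^{-1}\}\big)\sim \tfrac12\, n\log n,$$ $$\mathbb{E}\,N_H\big(\{z: |z|^2\ge 1+(\log n)^{-1}\}\big)=O(n\log\log n).$$
   Context: Harmonic Kac ensemble: for integers $n\ge m\ge 1$, $H(z)=p_n(z)+\overline{q_m(z)}$ with $p_n(z)=\sum_{k=0}^n A_k z^k$ and $q_m(z)=\sum_{k=0}^m B_k z^k$, where $A_0,\dots,A_n,B_0,\dots,B_m$ are i.i.d. standard complex Gaussians, i.e. each equals $X+iY$ with $X,Y$ independent real $N(0,1/2)$ variables. For a set $T\subseteq\mathbb{C}$, $N_H(T)$ denotes the number of zeros of $H$ in $T$. $\log$ is the natural logarithm. *)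

theory Defs
  imports "HOL-Probability.Probability" "HOL-Library.Landau_Symbols"
begin

text \<open>Standard complex Gaussian: density exp(-|z|^2)/pi w.r.t. Lebesgue measure on C = R^2,
  i.e. X + iY with X, Y independent N(0,1/2).\<close>
definition cgauss :: "complex measure" where
  "cgauss = density lborel (\<lambda>z. ennreal (exp (- (cmod z)\<^sup>2) / pi))"

definition kac_coeffs :: "nat \<Rightarrow> ((nat \<Rightarrow> complex) \<times> (nat \<Rightarrow> complex)) measure" where
  "kac_coeffs n = PiM {..n} (\<lambda>_. cgauss) \<Otimes>\<^sub>M PiM {..n} (\<lambda>_. cgauss)"

definition harm_poly :: "nat \<Rightarrow> (nat \<Rightarrow> complex) \<times> (nat \<Rightarrow> complex) \<Rightarrow> complex \<Rightarrow> complex" where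
  "harm_poly n \<omega> z = (\<Sum>k\<le>n. fst \<omega> k * z ^ k) + cnj (\<Sum>k\<le>n. snd \<omega> k * z ^ k)"

definition num_zeros :: "(complex \<Rightarrow> complex) \<Rightarrow> complex set \<Rightarrow> ennreal" where
  "num_zeros H T = (if finite {z\<in>T. H z = 0} then of_nat (card {z\<in>T. H z = 0}) else \<infinity>)"

definition expected_zeros :: "nat \<Rightarrow> complex set \<Rightarrow> ennreal" where
  "expected_zeros n T = (\<integral>\<^sup>+ \<omega>. num_zeros (harm_poly n \<omega>) T \<partial>kac_coeffs n)"

end

(*
  The equation H(z) = 0 says that the constant coefficient A_0 equals -(H - A_0)(z).  Integrating the
  number of zeros over A_0 first, the area formula turns it into an integral over z of the Gaussian
  density at that value times the absolute Jacobian ||p'|^2 - |q'|^2|; this is the Kac-Rice formula.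
  For fixed z the integrand is a function of three linear functionals of i.i.d. complex Gaussians, so it
  only depends on their Gram matrix, and unitary rotations of pairs of coefficients bring them to
  triangular form.  After conditioning, the Jacobian is distributed as a multiple of |X|^2 - |Y|^2,
  whose absolute value has mean 1.  In the variable r = |z|^2 this gives the density
    sqrt(c^2 - c r b^2 / a) / (2 a),  a = sum r^k,  b = sum k r^(k-1),  c = sum k^2 r^(k-1).
  From (r - 1)^2 (a c - r b^2) = a^2 - (n + 1)^2 r^n the density is at most n / (2 (r - 1)) for r > 1, which is
  sharp between 1 + (log n)^2 / n and 1 + 1 / log n, at most 1 / (1 - r)^2 for r < 1, and at most n^2 / 2
  everywhere.
*)
theory Submission
  imports Defs "HOL-Real_Asymp.Real_Asymp"
begin

section \<open>The area formula in the plane\<close>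

text \<open>Solving for A_0 removes the regularity questions of Kac-Rice: A_0 enters H additively
  and independently, so the formula is an exact change of variables for every value of the other
  coefficients. A_0 has variance 1 and H - A_0 has variance 2a - 1, whence the factor 2a. With m =
  n, p' and q' have equal variances, also after conditioning on H = 0. In standard Gaussian
  coordinates the form |p'|^2 - |q'|^2 then has opposite eigenvalues, and its mean absolute value is
  a single square root. The logarithms come from integrating n / (2 (r - 1)). Put L = log n. Between
  r - 1 = L^2 / n and r - 1 = 1 / L the integral is (n / 2) (log n - 3 log L); between 1 / n and L^2
  / n it is n log L; between 1 / L and 1 it is (n / 2) log L. The part below r = 1 + 1 / n is O(n).
  The cut-off L^2 / n makes r^n superpolynomial, so the correction (n + 1)^2 r^n / a^2 vanishes
  uniformly on the annulus.\<close>

lemma nn_integral_change_of_variables_inj: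
  fixes g :: "real^'n::{finite,wellorder} \<Rightarrow> real^'n::_" and \<phi> :: "real^'n::_ \<Rightarrow> real"
  assumes S: "S \<in> sets lebesgue"
    and der: "\<And>x. x \<in> S \<Longrightarrow> (g has_derivative g' x) (at x within S)"
    and inj: "inj_on g S"
    and \<phi>: "integrable lborel \<phi>" "\<And>x. 0 \<le> \<phi> x"
  shows "(\<integral>\<^sup>+w. ennreal (\<phi> w) * indicator (g ` S) w \<partial>lebesgue) =
    (\<integral>\<^sup>+z. ennreal (\<phi> (g z) * \<bar>det (matrix (g' z))\<bar>) * indicator S z \<partial>lebesgue)"
proof -
  have gS: "g ` S \<in> sets lebesgue"
    using der by (intro differentiable_image_in_sets_lebesgue[OF S]) (auto simp: differentiable_on_def differentiable_def)
  have "integrable lebesgue \<phi>"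
    using \<phi>(1) integrable_completion[of \<phi> lborel] borel_measurable_integrable by blast
  then have ai: "\<phi> absolutely_integrable_on (g ` S)"
    unfolding set_integrable_def by (intro integrable_mult_indicator gS)
  define I where "I = integral (g ` S) \<phi>"
  have hI: "(\<phi> has_integral I) (g ` S)"
    using set_lebesgue_integral_eq_integral(1)[OF ai] by (simp add: I_def has_integral_integral)
  have 1: "(\<integral>\<^sup>+w. ennreal (\<phi> w) * indicator (g ` S) w \<partial>lebesgue) = ennreal I"
    using nn_integral_has_integral_lebesgue'[OF _ hI] \<phi>(2) by (simp add: nn_integral_completion)
  \<comment> \<open>The change-of-variables theorem speaks of integrands with values in a Cartesian
    space, so the real weight enters as a one-dimensional vector.\<close>
  have "(vec \<circ> \<phi> :: _ \<Rightarrow> real^1) absolutely_integrable_on (g ` S) \<and> integral (g ` S) (vec \<circ> \<phi> :: _ \<Rightarrow> real^1) = vec I"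
    using ai by (simp add: absolutely_integrable_on_1_iff integral_on_1_eq I_def o_def)
  then have "(\<lambda>x. \<bar>det (matrix (g' x))\<bar> *\<^sub>R (vec \<circ> \<phi> :: _ \<Rightarrow> real^1) (g x)) absolutely_integrable_on S \<and>
      integral S (\<lambda>x. \<bar>det (matrix (g' x))\<bar> *\<^sub>R (vec \<circ> \<phi> :: _ \<Rightarrow> real^1) (g x)) = vec I"
    using has_absolute_integral_change_of_variables[OF S der inj, of "vec \<circ> \<phi> :: _ \<Rightarrow> real^1" "vec I"] by blast
  then have "(\<lambda>x. \<bar>det (matrix (g' x))\<bar> * \<phi> (g x)) absolutely_integrable_on S \<and>
      integral S (\<lambda>x. \<bar>det (matrix (g' x))\<bar> * \<phi> (g x)) = I"
    by (simp add: absolutely_integrable_on_1_iff integral_on_1_eq o_def vec_eq_iff)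
  then have "((\<lambda>x. \<phi> (g x) * \<bar>det (matrix (g' x))\<bar>) has_integral I) S"
    using set_lebesgue_integral_eq_integral(1) has_integral_integral by (fastforce simp: mult.commute)
  then have 2: "(\<integral>\<^sup>+z. ennreal (\<phi> (g z) * \<bar>det (matrix (g' z))\<bar>) * indicator S z \<partial>lebesgue) = ennreal I"
    using \<phi>(2) by (subst nn_integral_completion, intro nn_integral_has_integral_lebesgue') auto
  show ?thesis using 1 2 by simp
qed

text \<open>Where the Jacobian is nonzero, \<open>g\<close> is locally injective, and by the
  Lindelof property countably many balls of injectivity cover this set. Cutting them into disjoint
  pieces makes the count a sum of indicators of images, and the injective case applies to each
  piece. Critical points contribute to neither side: their image is null by Sard's theorem, and on
  the right their weight is zero.\<close>

theorem area_formula: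
  fixes g :: "real^'n::{finite,wellorder} \<Rightarrow> real^'n::_" and \<phi> :: "real^'n::_ \<Rightarrow> real"
  assumes T: "T \<in> sets borel"
    and der: "\<And>x. (g has_derivative g' x) (at x)"
    and cont: "\<And>a e. e > 0 \<Longrightarrow> \<exists>d>0. \<forall>x. dist a x < d \<longrightarrow> onorm (\<lambda>v. g' x v - g' a v) < e"
    and \<phi>: "integrable lborel \<phi>" "\<And>x. 0 \<le> \<phi> x"
  shows "(\<integral>\<^sup>+w. ennreal (\<phi> w) * emeasure (count_space UNIV) {z\<in>T. g z = w} \<partial>lborel) =
    (\<integral>\<^sup>+z. ennreal (\<phi> (g z) * \<bar>det (matrix (g' z))\<bar>) * indicator T z \<partial>lborel)"
proof -
  let ?c = "\<lambda>S w. emeasure (count_space UNIV) {z\<in>S. g z = w}"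
  have lin: "linear (g' x)" for x using der has_derivative_linear by blast
  \<comment> \<open>The Jacobian determinant is obtained as a Lebesgue measurable function only, so
    all pieces are treated over the completion and the result is carried back to
    \<open>lborel\<close> at the end.\<close>
  have detm: "(\<lambda>x. det (matrix (g' x))) \<in> borel_measurable lebesgue"
    using borel_measurable_det_Jacobian[of UNIV g g'] der by (simp add: lebesgue_on_UNIV_eq)
  define U where "U = {x. det (matrix (g' x)) \<noteq> 0}"
  have U: "U \<in> sets lebesgue"
    using measurable_sets[OF detm, of "-{0}"] by (simp add: U_def vimage_def)
  have TL: "T \<in> sets lebesgue" using T by (auto intro: sets_completionI_sets)
  have loc: "\<exists>r>0. inj_on g (ball a r)" if "a \<in> U" for a
  proof -
    have "inj (g' a)" using that lin[of a] by (simp add: U_def det_nz_iff_inj)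
    then obtain h where h: "linear h" "h \<circ> g' a = id"
      using linear_injective_left_inverse[OF lin[of a]] by blast
    have "bounded_linear h" using h(1) by (simp add: linear_conv_bounded_linear)
    then show ?thesis
      by (rule has_derivative_locally_injective[OF UNIV_I open_UNIV _ h(2) der cont]) auto
  qed
  then obtain r where r: "\<And>a. a \<in> U \<Longrightarrow> r a > 0" "\<And>a. a \<in> U \<Longrightarrow> inj_on g (ball a (r a))" by metis
  obtain F where F: "F \<subseteq> (\<lambda>a. ball a (r a)) ` U" "countable F" "\<Union>F = (\<Union>a\<in>U. ball a (r a))"
    using Lindelof[of "(\<lambda>a. ball a (r a)) ` U"] by auto
  \<comment> \<open>The empty set is added because \<open>F\<close> itself is empty when there are
    no regular points, and the enumeration needs a nonempty set.\<close>
  define B where "B = (\<lambda>i::nat. from_nat_into (insert {} F) i)"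
  have rB: "range B = insert {} F" unfolding B_def using F(2) by (simp add: range_from_nat_into)
  have Bop: "open (B i)" and Binj: "inj_on g (B i)" for i
  proof -
    have "B i \<in> insert {} F" using rB by blast
    then show "open (B i)" "inj_on g (B i)" using F(1) r(2) by auto
  qed
  have UB: "U \<subseteq> (\<Union>i. B i)"
  proof -
    have "\<Union>(range B) = \<Union>F" by (simp add: rB)
    moreover have "U \<subseteq> (\<Union>a\<in>U. ball a (r a))"
      using r(1) by (intro subsetI UN_I) auto
    ultimately show ?thesis by (simp only: F(3))
  qed
  define S where "S i = disjointed B i \<inter> (U \<inter> T)" for i
  have SL: "S i \<in> sets lebesgue" for i
  proof -
    have "disjointed B i \<in> sets borel" using Bop
      by (intro sets.range_disjointed_sets[THEN subsetD] range_eqI) (auto intro: borel_open)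
    then show ?thesis unfolding S_def using U TL by (auto intro: sets_completionI_sets)
  qed
  have Sinj: "inj_on g (S i)" for i
    by (rule inj_on_subset[OF Binj[of i]]) (use disjointed_subset[of B i] in \<open>auto simp: S_def\<close>)
  have Sdisj: "disjoint_family S"
    using disjoint_family_disjointed[of B] unfolding disjoint_family_on_def S_def by blast
  have SUn: "(\<Union>i. S i) = U \<inter> T"
    using UB UN_disjointed_eq[of B] by (auto simp: S_def)
  have cS: "?c (S i) w = indicator (g ` S i) w" for i w
  proof (cases "w \<in> g ` S i")
    case True
    then obtain z where z: "z \<in> S i" "w = g z" by blast
    then have "{z\<in>S i. g z = w} = {z}" using Sinj[of i] by (auto dest: inj_onD)
    then show ?thesis using True by simp
  next
    case False
    then have "{z\<in>S i. g z = w} = {}" by auto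
    then show ?thesis using False by (simp only: emeasure_empty) simp
  qed
  have cU: "?c (U \<inter> T) w = (\<Sum>i. indicator (g ` S i) w)" for w
  proof -
    have "(\<Sum>i. ?c (S i) w) = emeasure (count_space UNIV) (\<Union>i. {z\<in>S i. g z = w})"
      using Sdisj by (intro suminf_emeasure) (auto simp: disjoint_family_on_def)
    also have "(\<Union>i. {z\<in>S i. g z = w}) = {z\<in>U \<inter> T. g z = w}" using SUn by blast
    finally show ?thesis by (simp add: cS)
  qed
  have "negligible (g ` (T - U))"
  proof (rule baby_Sard)
    show "(g has_derivative g' x) (at x within T - U)" for x
      using der has_derivative_at_withinI by blast
    show "rank (matrix (g' x)) < CARD('n)" if "x \<in> T - U" for x
      using that by (auto simp: U_def det_eq_0_rank)
  qed simp
  then have AE: "AE w in lebesgue. w \<notin> g ` (T - U)"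
    by (simp add: AE_not_in negligible_iff_null_sets)
  have gS: "g ` S i \<in> sets lebesgue" for i
    by (intro differentiable_image_in_sets_lebesgue[OF SL])
      (use der in \<open>auto simp: differentiable_on_def differentiable_def intro: has_derivative_at_withinI\<close>)
  have \<phi>m: "\<phi> \<in> borel_measurable lebesgue"
    using \<phi>(1) by (auto intro: measurable_completion)
  have gm: "(\<lambda>z. \<phi> (g z) * \<bar>det (matrix (g' z))\<bar>) \<in> borel_measurable lebesgue"
  proof -
    have "continuous_on UNIV g"
      using der has_derivative_continuous_on[of UNIV g g'] has_derivative_at_withinI by blast
    then have "g \<in> borel_measurable borel" by (rule borel_measurable_continuous_onI)
    then have "(\<lambda>z. \<phi> (g z)) \<in> borel_measurable borel"
      using \<phi>(1) by (intro measurable_compose[of g borel borel \<phi>]) auto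
    then have "(\<lambda>z. \<phi> (g z)) \<in> borel_measurable lebesgue" by (auto intro: measurable_completion)
    then show ?thesis using detm by measurable
  qed
  note [measurable] = \<phi>m gS gm SL
  have "(\<integral>\<^sup>+w. ennreal (\<phi> w) * ?c T w \<partial>lborel) = (\<integral>\<^sup>+w. ennreal (\<phi> w) * ?c T w \<partial>lebesgue)"
    by (simp add: nn_integral_completion)
  also have "\<dots> = (\<integral>\<^sup>+w. (\<Sum>i. ennreal (\<phi> w) * indicator (g ` S i) w) \<partial>lebesgue)"
  proof (rule nn_integral_cong_AE, use AE in eventually_elim)
    fix w assume "w \<notin> g ` (T - U)"
    then have "{z\<in>T. g z = w} = {z\<in>U \<inter> T. g z = w}" by auto
    then show "ennreal (\<phi> w) * ?c T w = (\<Sum>i. ennreal (\<phi> w) * indicator (g ` S i) w)"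
      using cU by simp
  qed
  also have "\<dots> = (\<Sum>i. \<integral>\<^sup>+w. ennreal (\<phi> w) * indicator (g ` S i) w \<partial>lebesgue)"
    by (intro nn_integral_suminf) measurable
  also have "\<dots> = (\<Sum>i. \<integral>\<^sup>+z. ennreal (\<phi> (g z) * \<bar>det (matrix (g' z))\<bar>) * indicator (S i) z \<partial>lebesgue)"
    by (intro suminf_cong nn_integral_change_of_variables_inj SL Sinj \<phi>)
      (use der has_derivative_at_withinI in blast)
  also have "\<dots> = (\<integral>\<^sup>+z. (\<Sum>i. ennreal (\<phi> (g z) * \<bar>det (matrix (g' z))\<bar>) * indicator (S i) z) \<partial>lebesgue)"
    by (intro nn_integral_suminf[symmetric]) measurable
  also have "\<dots> = (\<integral>\<^sup>+z. ennreal (\<phi> (g z) * \<bar>det (matrix (g' z))\<bar>) * indicator T z \<partial>lebesgue)"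
  proof (rule nn_integral_cong)
    fix z
    have "(\<Sum>i. indicator (S i) z :: ennreal) = indicator (U \<inter> T) z"
      using suminf_indicator[OF Sdisj, of z] SUn by simp
    then show "(\<Sum>i. ennreal (\<phi> (g z) * \<bar>det (matrix (g' z))\<bar>) * indicator (S i) z) =
       ennreal (\<phi> (g z) * \<bar>det (matrix (g' z))\<bar>) * indicator T z"
      by (auto simp: U_def indicator_def)
  qed
  finally show ?thesis by (simp add: nn_integral_completion)
qed

section \<open>Transport of the area formula to the complex plane\<close>

definition vec_complex :: "real^2 \<Rightarrow> complex" where
  "vec_complex x = Complex (x$1) (x$2)"

definition complex_vec :: "complex \<Rightarrow> real^2" where
  "complex_vec z = vector [Re z, Im z]"

lemma complex_vec_nth [simp]: "complex_vec z $ 1 = Re z" "complex_vec z $ 2 = Im z"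
  by (simp_all add: complex_vec_def)

lemma vec_complex_inverse [simp]: "complex_vec (vec_complex x) = x"
  by (simp add: vec_complex_def vec_eq_iff forall_2)

lemma complex_vec_inverse [simp]: "vec_complex (complex_vec z) = z"
  by (simp add: vec_complex_def)

lemma norm_complex_vec [simp]: "norm (complex_vec z) = cmod z"
  by (simp add: norm_vec_def L2_set_def sum_2 cmod_def)

lemma norm_vec_complex [simp]: "cmod (vec_complex x) = norm x"
  by (metis norm_complex_vec vec_complex_inverse)

lemma bounded_linear_complex_vec: "bounded_linear complex_vec"
  by (rule bounded_linear_intro[where K=1]) (auto simp: vec_eq_iff forall_2)

lemma bounded_linear_vec_complex: "bounded_linear vec_complex"
  by (rule bounded_linear_intro[where K=1]) (simp_all add: complex_eq_iff, simp_all add: vec_complex_def)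

lemma measurable_complex_vec [measurable]: "complex_vec \<in> borel_measurable borel"
  and measurable_vec_complex [measurable]: "vec_complex \<in> borel_measurable borel"
  using bounded_linear_complex_vec bounded_linear_vec_complex
  by (auto intro: borel_measurable_continuous_onI linear_continuous_on)

lemma Basis_vec_2: "(Basis :: (real^2) set) = {axis 1 1, axis 2 1}"
  by (auto simp: Basis_vec_def UNIV_2)

lemma distr_vec_complex: "distr lborel borel vec_complex = lborel"
proof (rule lborel_eqI[symmetric])
  fix l u :: complex
  assume le: "\<And>b. b \<in> Basis \<Longrightarrow> l \<bullet> b \<le> u \<bullet> b"
  have "vec_complex -` box l u = box (complex_vec l) (complex_vec u)"
    by (auto simp: mem_box_cart forall_2 vec_complex_def in_box_complex_iff)
  moreover have "axis 1 (1::real) \<noteq> (axis 2 1 :: real^2)"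
    by (simp add: axis_eq_axis)
  ultimately show "emeasure (distr lborel borel vec_complex) (box l u) = (\<Prod>b\<in>Basis. (u - l) \<bullet> b)"
    using le[of 1] le[of \<i>] by (subst emeasure_distr) (auto simp: emeasure_lborel_box_eq Basis_vec_2 Basis_complex_def inner_axis)
qed simp

lemma nn_integral_lborel_complex_vec:
  assumes "f \<in> borel_measurable borel"
  shows "(\<integral>\<^sup>+z. f z \<partial>lborel) = (\<integral>\<^sup>+x. f (vec_complex x) \<partial>lborel)"
  using assms by (subst distr_vec_complex[symmetric]) (simp add: nn_integral_distr)

text \<open>A real-linear map \<open>h \<mapsto> \<alpha> h + cnj (\<beta> h)\<close> has
  determinant |\<alpha>|^2 - |\<beta>|^2, which is the Jacobian of a harmonic map with analytic part
  of derivative \<alpha> and conjugate part of derivative \<beta>. The measurability of the count is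
  assumed because the left integral is moved along the isometry between the plane and
  \<open>real^2\<close>.\<close>

theorem area_formula_complex:
  fixes G :: "complex \<Rightarrow> complex" and \<phi> :: "complex \<Rightarrow> real"
  assumes T: "T \<in> sets borel"
    and der: "\<And>z. (G has_derivative (\<lambda>h. \<alpha> z * h + cnj (\<beta> z * h))) (at z)"
    and cont: "continuous_on UNIV \<alpha>" "continuous_on UNIV \<beta>"
    and \<phi>: "integrable lborel \<phi>" "\<And>x. 0 \<le> \<phi> x"
    and meas: "(\<lambda>w. emeasure (count_space UNIV) {z\<in>T. G z = w}) \<in> borel_measurable borel"
  shows "(\<integral>\<^sup>+w. ennreal (\<phi> w) * emeasure (count_space UNIV) {z\<in>T. G z = w} \<partial>lborel) =
    (\<integral>\<^sup>+z. ennreal (\<phi> (G z) * \<bar>(cmod (\<alpha> z))\<^sup>2 - (cmod (\<beta> z))\<^sup>2\<bar>) * indicator T z \<partial>lborel)"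
proof -
  let ?g = "\<lambda>x. complex_vec (G (vec_complex x))"
  let ?L = "\<lambda>z h. \<alpha> z * h + cnj (\<beta> z * h)"
  let ?g' = "\<lambda>x h. complex_vec (?L (vec_complex x) (vec_complex h))"
  have [measurable]: "\<phi> \<in> borel_measurable borel" using \<phi>(1) by auto
  have contG: "continuous_on UNIV G"
    by (intro continuous_at_imp_continuous_on ballI has_derivative_continuous[OF der])
  note [measurable] = T cont[THEN borel_measurable_continuous_onI] contG[THEN borel_measurable_continuous_onI] meas
  have dg: "(?g has_derivative ?g' x) (at x)" for x
  proof -
    have "(G has_derivative ?L (vec_complex x)) (at (vec_complex x))" by (rule der)
    from has_derivative_compose[OF bounded_linear.has_derivative[OF bounded_linear_vec_complex has_derivative_ident] this]
    have "((\<lambda>x. G (vec_complex x)) has_derivative (\<lambda>h. ?L (vec_complex x) (vec_complex h))) (at x)" .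
    from bounded_linear.has_derivative[OF bounded_linear_complex_vec this] show ?thesis .
  qed
  have det: "det (matrix (?g' x)) = (cmod (\<alpha> (vec_complex x)))\<^sup>2 - (cmod (\<beta> (vec_complex x)))\<^sup>2" for x
    by (simp add: det_2 matrix_def vec_complex_def axis_def cmod_power2) (simp add: power2_eq_square algebra_simps)
  have co: "\<exists>d>0. \<forall>x. dist a x < d \<longrightarrow> onorm (\<lambda>v. ?g' x v - ?g' a v) < e" if "e > 0" for a e
  proof -
    have "continuous_on UNIV (\<lambda>x. \<alpha> (vec_complex x))" "continuous_on UNIV (\<lambda>x. \<beta> (vec_complex x))"
      by (rule continuous_on_compose2[OF cont(1) linear_continuous_on[OF bounded_linear_vec_complex]]
            continuous_on_compose2[OF cont(2) linear_continuous_on[OF bounded_linear_vec_complex]], simp)+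
    then have "continuous (at a) (\<lambda>x. \<alpha> (vec_complex x))" "continuous (at a) (\<lambda>x. \<beta> (vec_complex x))"
      by (simp_all add: continuous_on_eq_continuous_at)
    then obtain d1 d2 where d: "d1 > 0" "d2 > 0"
      "\<And>x. dist x a < d1 \<Longrightarrow> dist (\<alpha> (vec_complex x)) (\<alpha> (vec_complex a)) < e/3"
      "\<And>x. dist x a < d2 \<Longrightarrow> dist (\<beta> (vec_complex x)) (\<beta> (vec_complex a)) < e/3"
      using \<open>e > 0\<close> unfolding continuous_at_eps_delta
      by (elim allE[of _ "e/3"]) auto
    show ?thesis
    proof (intro exI[of _ "min d1 d2"] conjI allI impI)
      fix x assume x: "dist a x < min d1 d2"
      let ?A = "\<alpha> (vec_complex x) - \<alpha> (vec_complex a)" and ?B = "\<beta> (vec_complex x) - \<beta> (vec_complex a)"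
      have AB: "cmod ?A < e/3" "cmod ?B < e/3"
        using d(3)[of x] d(4)[of x] x by (simp_all add: dist_commute[of a x]) (simp_all add: dist_norm)
      have "onorm (\<lambda>v. ?g' x v - ?g' a v) \<le> 2 * e / 3"
      proof (rule onorm_le)
        fix v
        have "?g' x v - ?g' a v = complex_vec (?L (vec_complex x) (vec_complex v) - ?L (vec_complex a) (vec_complex v))"
          by (simp only: linear_diff[OF bounded_linear.linear[OF bounded_linear_complex_vec]])
        then have "norm (?g' x v - ?g' a v) = cmod (?A * vec_complex v + cnj (?B * vec_complex v))"
          by (simp only: norm_complex_vec) (simp add: algebra_simps)
        also have "\<dots> \<le> cmod ?A * norm v + cmod ?B * norm v"
          by (rule norm_triangle_le) (simp only: norm_mult complex_mod_cnj norm_vec_complex order_refl)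
        also have "\<dots> \<le> (e/3) * norm v + (e/3) * norm v"
          using AB by (intro add_mono mult_right_mono) auto
        finally show "norm (?g' x v - ?g' a v) \<le> 2 * e / 3 * norm v" by simp
      qed
      then show "onorm (\<lambda>v. ?g' x v - ?g' a v) < e" using \<open>e > 0\<close> by simp
    qed (use d in auto)
  qed
  let ?\<phi> = "\<lambda>x. \<phi> (vec_complex x)"
  have int: "integrable lborel ?\<phi>"
    using \<phi>(1) integrable_distr_eq[of vec_complex lborel borel \<phi>] by (simp add: distr_vec_complex)
  define T' where "T' = vec_complex -` T"
  have T': "T' \<in> sets borel"
    unfolding T'_def using measurable_sets[OF measurable_vec_complex T] by simp
  have "bij vec_complex"
    by (rule bijI') (metis vec_complex_inverse, metis complex_vec_inverse)
  have ceq: "emeasure (count_space UNIV) {z\<in>T. G z = vec_complex w} =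
      emeasure (count_space UNIV) {x\<in>T'. ?g x = w}" for w
  proof -
    have "bij_betw vec_complex {x\<in>T'. ?g x = w} {z\<in>T. G z = vec_complex w}"
      unfolding bij_betw_def T'_def
    proof (intro conjI inj_on_subset[OF bij_is_inj[OF \<open>bij vec_complex\<close>]] equalityI subsetI)
      fix z assume "z \<in> {z\<in>T. G z = vec_complex w}"
      then show "z \<in> vec_complex ` {x \<in> vec_complex -` T. ?g x = w}"
        by (intro image_eqI[of _ _ "complex_vec z"]) auto
    qed auto
    from bij_betw_finite[OF this] bij_betw_same_card[OF this] show ?thesis
      by (cases "finite {x\<in>T'. ?g x = w}") (auto simp: emeasure_count_space)
  qed
  have "(\<integral>\<^sup>+w. ennreal (\<phi> w) * emeasure (count_space UNIV) {z\<in>T. G z = w} \<partial>lborel) =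
      (\<integral>\<^sup>+w. ennreal (?\<phi> w) * emeasure (count_space UNIV) {x\<in>T'. ?g x = w} \<partial>lborel)"
    by (subst nn_integral_lborel_complex_vec) (measurable, simp add: ceq)
  also have "\<dots> = (\<integral>\<^sup>+x. ennreal (?\<phi> (?g x) * \<bar>det (matrix (?g' x))\<bar>) * indicator T' x \<partial>lborel)"
    by (rule area_formula[OF T' dg co int]) (auto simp: \<phi>(2))
  also have "\<dots> = (\<integral>\<^sup>+z. ennreal (\<phi> (G z) * \<bar>(cmod (\<alpha> z))\<^sup>2 - (cmod (\<beta> z))\<^sup>2\<bar>) * indicator T z \<partial>lborel)"
    by (subst nn_integral_lborel_complex_vec) (measurable, unfold det, simp add: T'_def indicator_def)
  finally show ?thesis .
qed

section \<open>Measurability of the number of zeros\<close>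

text \<open>On a compact set |H| attains its minimum, so a zero exists exactly when |H| becomes
  arbitrarily small on a countable dense subset. That is a countable condition on values at fixed
  points.\<close>

lemma sets_ex_zero_in_compact:
  fixes H :: "'w \<Rightarrow> 'a::{metric_space,second_countable_topology} \<Rightarrow> complex"
  assumes [measurable]: "\<And>z. (\<lambda>\<omega>. H \<omega> z) \<in> borel_measurable M"
    and cont: "\<And>\<omega>. continuous_on UNIV (H \<omega>)" and K: "compact K"
  shows "{\<omega>\<in>space M. \<exists>z\<in>K. H \<omega> z = 0} \<in> sets M"
proof -
  obtain D where D: "countable D" "D \<subseteq> K" "K \<subseteq> closure D" by (rule separable)
  have "{\<omega>\<in>space M. \<exists>z\<in>K. H \<omega> z = 0} = {\<omega>\<in>space M. \<forall>n::nat. \<exists>z\<in>D. cmod (H \<omega> z) < 1 / Suc n}"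
  proof (safe)
    fix \<omega> z and n :: nat assume z: "z \<in> K" "H \<omega> z = 0"
    have "isCont (H \<omega>) z" using cont by (simp add: continuous_on_eq_continuous_at)
    then obtain d where d: "d > 0" "\<And>x. dist x z < d \<Longrightarrow> dist (H \<omega> x) (H \<omega> z) < 1 / Suc n"
      unfolding continuous_at_eps_delta by (metis of_nat_0_less_iff zero_less_Suc zero_less_divide_1_iff)
    obtain x where "x \<in> D" "dist x z < d" using D(3) z(1) d(1) closure_approachable by blast
    then show "\<exists>z\<in>D. cmod (H \<omega> z) < 1 / Suc n" using d(2)[of x] z(2) by (auto simp: dist_norm)
  next
    fix \<omega> assume *: "\<forall>n::nat. \<exists>z\<in>D. cmod (H \<omega> z) < 1 / Suc n"
    then have "K \<noteq> {}" using D(2) by blast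
    moreover have "continuous_on K (\<lambda>z. cmod (H \<omega> z))"
      using cont continuous_on_subset by (intro continuous_on_norm) blast
    ultimately obtain z where z: "z \<in> K" "\<And>y. y \<in> K \<Longrightarrow> cmod (H \<omega> z) \<le> cmod (H \<omega> y)"
      using continuous_attains_inf[OF K] by blast
    have "cmod (H \<omega> z) < 1 / Suc n" for n using * z(2) D(2) by (meson le_less_trans subsetD)
    then have "\<not> cmod (H \<omega> z) > 0" using reals_Archimedean[of "cmod (H \<omega> z)"] by (auto simp: inverse_eq_divide dest: less_asym)
    then show "\<exists>z\<in>K. H \<omega> z = 0" using z(1) by auto
  qed
  moreover have "{\<omega>\<in>space M. \<forall>n::nat. \<exists>z\<in>D. cmod (H \<omega> z) < 1 / Suc n} \<in> sets M"
    using D(1) by measurable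
  ultimately show ?thesis by simp
qed

lemma finite_points_separated:
  fixes X :: "'a::metric_space set"
  assumes "finite X"
  obtains d where "d > 0" "\<And>x y. x \<in> X \<Longrightarrow> y \<in> X \<Longrightarrow> x \<noteq> y \<Longrightarrow> d \<le> dist x y"
proof -
  define A where "A = (\<lambda>(x, y). dist x y) ` {(x, y) \<in> X \<times> X. x \<noteq> y}"
  have fin: "finite A" unfolding A_def
    by (rule finite_imageI, rule finite_subset[OF _ finite_cartesian_product[OF assms assms]]) auto
  have pos: "\<And>a. a \<in> A \<Longrightarrow> a > 0" by (auto simp: A_def)
  show ?thesis
  \<comment> \<open>Inserting 1 keeps the minimum meaningful when there are fewer than two
    points.\<close>
  proof (rule that[of "Min (insert 1 A)"])
    show "Min (insert 1 A) > 0" using fin pos by auto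
    fix x y assume "x \<in> X" "y \<in> X" "x \<noteq> y"
    then have "dist x y \<in> A" by (force simp: A_def)
    then show "Min (insert 1 A) \<le> dist x y" using fin by auto
  qed
qed

text \<open>The count is the supremum, over the countably many finite disjoint families of balls
  with dense centres and rational radii, of the number of balls containing a zero. Disjoint balls
  contain distinct zeros, and any finite set of zeros is separated by such a family. Closedness of
  \<open>T\<close> makes each ball meet \<open>T\<close> in a compact set. The supremum also yields
  infinity for infinite zero sets.\<close>

theorem measurable_count_zeros:
  fixes H :: "'w \<Rightarrow> 'a::euclidean_space \<Rightarrow> complex"
  assumes H: "\<And>z. (\<lambda>\<omega>. H \<omega> z) \<in> borel_measurable M"
    and cont: "\<And>\<omega>. continuous_on UNIV (H \<omega>)" and T: "closed T"
  shows "(\<lambda>\<omega>. emeasure (count_space UNIV) {z\<in>T. H \<omega> z = 0}) \<in> borel_measurable M"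
proof -
  obtain D :: "'a set" where D: "countable D" "D \<subseteq> UNIV" "UNIV \<subseteq> closure D"
    using separable[of UNIV] by metis
  define \<B> where "\<B> = (\<lambda>(p, r). cball p r) ` (D \<times> (\<rat>::real set))"
  define \<F> where "\<F> = {F. finite F \<and> F \<subseteq> \<B> \<and> disjoint F}"
  define f where "f F \<omega> = (\<Sum>B\<in>F. indicator {\<omega>\<in>space M. \<exists>z\<in>B \<inter> T. H \<omega> z = 0} \<omega> :: ennreal)" for F \<omega>
  have "countable \<B>" unfolding \<B>_def using D(1) countable_rat by (intro countable_image countable_SIGMA) auto
  then have "countable {F. finite F \<and> F \<subseteq> \<B>}" by (rule countable_Collect_finite_subset)
  then have "countable \<F>" by (rule countable_subset[rotated]) (auto simp: \<F>_def)
  have [measurable]: "f F \<in> borel_measurable M" if "F \<in> \<F>" for F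
    unfolding f_def
  proof (intro borel_measurable_sum borel_measurable_indicator sets_ex_zero_in_compact H cont)
    fix B assume "B \<in> F"
    then have "compact B" using that by (auto simp: \<F>_def \<B>_def)
    then show "compact (B \<inter> T)" using T by (rule compact_Int_closed)
  qed
  have "emeasure (count_space UNIV) {z\<in>T. H \<omega> z = 0} = (SUP F\<in>\<F>. f F \<omega>)" if \<omega>: "\<omega> \<in> space M" for \<omega>
  proof (rule antisym)
    let ?Z = "{z\<in>T. H \<omega> z = 0}"
    have sep: "of_nat (card X) \<le> (SUP F\<in>\<F>. f F \<omega>)" if X: "finite X" "X \<subseteq> ?Z" for X
    proof -
      obtain d where d: "d > 0" "\<And>x y. x \<in> X \<Longrightarrow> y \<in> X \<Longrightarrow> x \<noteq> y \<Longrightarrow> d \<le> dist x y"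
        using finite_points_separated[OF X(1)] by metis
      \<comment> \<open>A common point of two balls would link the two zeros by four segments of
        length at most \<open>r\<close>, two of them strictly shorter; hence the bound
        \<open>d / 4\<close>.\<close>
      obtain r :: real where r: "r \<in> \<rat>" "0 < r" "r < d / 4"
        using Rats_dense_in_real[of 0 "d/4"] d(1) by auto
      have "\<exists>p\<in>D. dist p x < r" for x
        using D(3) r(2) closure_approachable[of x D] by auto
      then obtain p where p: "\<And>x. p x \<in> D" "\<And>x. dist (p x) x < r" by metis
      define b where "b x = cball (p x) r" for x
      have xb: "x \<in> b x" for x using p(2)[of x] by (simp add: b_def)
      have disj: "b x \<inter> b y = {}" if "x \<in> X" "y \<in> X" "x \<noteq> y" for x y
      proof (rule ccontr)
        assume "b x \<inter> b y \<noteq> {}"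
        then obtain u where "dist (p x) u \<le> r" "dist (p y) u \<le> r" by (auto simp: b_def)
        then have "dist x y < 4 * r" using p(2)[of x] p(2)[of y] by metric
        then show False using d(2)[OF that] r(3) by simp
      qed
      have inj: "inj_on b X" using disj xb by (metis disjoint_iff inj_onI)
      have "b ` X \<in> \<F>" unfolding \<F>_def using X(1) disj p(1) r(1)
        by (auto simp: \<B>_def b_def disjoint_def intro!: rev_image_eqI[of "(_, r)"])
      moreover have "f (b ` X) \<omega> = of_nat (card X)"
      proof -
        have "f (b ` X) \<omega> = (\<Sum>B\<in>b ` X. 1)"
          unfolding f_def using X(2) xb \<omega> by (intro sum.cong) (auto simp: indicator_def)
        then show ?thesis using card_image[OF inj] by simp
      qed
      ultimately show ?thesis by (metis SUP_upper)
    qed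
    show "emeasure (count_space UNIV) ?Z \<le> (SUP F\<in>\<F>. f F \<omega>)"
    proof (cases "finite ?Z")
      case True
      then show ?thesis using sep[of ?Z] by (simp add: emeasure_count_space)
    next
      case False
      have "of_nat n \<le> (SUP F\<in>\<F>. f F \<omega>)" for n
      proof -
        obtain X where "finite X" "X \<subseteq> ?Z" "card X = n"
          using infinite_arbitrarily_large[OF False] by blast
        then show ?thesis using sep by blast
      qed
      then have "(SUP F\<in>\<F>. f F \<omega>) = \<top>" using ennreal_SUP_of_nat_eq_top by (metis SUP_least top.extremum_uniqueI)
      then show ?thesis by (simp only: top_greatest)
    qed
    show "(SUP F\<in>\<F>. f F \<omega>) \<le> emeasure (count_space UNIV) ?Z"
    proof (rule SUP_least)
      fix F assume F: "F \<in> \<F>"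
      have "f F \<omega> \<le> (\<Sum>B\<in>F. emeasure (count_space UNIV) (B \<inter> ?Z))"
        unfolding f_def
      proof (rule sum_mono)
        fix B
        show "indicator {\<omega>\<in>space M. \<exists>z\<in>B \<inter> T. H \<omega> z = 0} \<omega> \<le> emeasure (count_space UNIV) (B \<inter> ?Z)"
        proof (cases "\<exists>z\<in>B \<inter> T. H \<omega> z = 0")
          case True
          then obtain z where "z \<in> B \<inter> ?Z" by blast
          then have "emeasure (count_space UNIV) {z} \<le> emeasure (count_space UNIV) (B \<inter> ?Z)"
            by (intro emeasure_mono) auto
          then show ?thesis by (simp add: indicator_def)
        qed (auto simp: indicator_def)
      qed
      also have "\<dots> = emeasure (count_space UNIV) (\<Union>B\<in>F. B \<inter> ?Z)"
        using F by (intro sum_emeasure) (auto simp: \<F>_def disjoint_family_on_def disjoint_def)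
      also have "\<dots> \<le> emeasure (count_space UNIV) ?Z" by (intro emeasure_mono) auto
      finally show "f F \<omega> \<le> emeasure (count_space UNIV) ?Z" .
    qed
  qed
  then show ?thesis
    using \<open>countable \<F>\<close> by (subst measurable_cong[where g="\<lambda>\<omega>. SUP F\<in>\<F>. f F \<omega>"]) (auto intro!: borel_measurable_SUP)
qed

section \<open>Complex Gaussians\<close>

lemma nn_integral_complex_affine:
  fixes c :: real and t :: complex
  assumes [measurable]: "f \<in> borel_measurable borel" and c: "c \<noteq> 0"
  shows "(\<integral>\<^sup>+x. f x \<partial>lborel) = ennreal (c\<^sup>2) * (\<integral>\<^sup>+x. f (t + of_real c * x) \<partial>lborel)"
  by (subst lborel_affine[OF c, of t])
    (simp add: nn_integral_density nn_integral_distr nn_integral_cmult scaleR_conv_of_real)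

lemma distr_lborel_cnj: "distr lborel borel cnj = lborel"
proof (rule lborel_eqI[symmetric])
  fix l u :: complex
  assume le: "\<And>b. b \<in> Basis \<Longrightarrow> l \<bullet> b \<le> u \<bullet> b"
  have "cnj -` box l u = box (Complex (Re l) (- Im u)) (Complex (Re u) (- Im l))"
    by (auto simp: in_box_complex_iff)
  moreover have "cnj \<in> borel_measurable borel"
    by (intro borel_measurable_continuous_onI continuous_intros)
  ultimately show "emeasure (distr lborel borel cnj) (box l u) = (\<Prod>b\<in>Basis. (u - l) \<bullet> b)"
    using le[of 1] le[of \<i>] by (subst emeasure_distr) (auto simp: emeasure_lborel_box_eq Basis_complex_def)
qed simp

text \<open>The disk |z|^2 \<le> a has area pi a, which is linear in \<open>a\<close>. In the
  variable |z|^2 rotation-invariant integrals therefore carry only the constant weight pi. The two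
  measures are compared on the half-lines, which are closed under intersection.\<close>

lemma distr_lborel_cmod_power2:
  "distr lborel borel (\<lambda>z::complex. (cmod z)\<^sup>2) = density lborel (\<lambda>r. ennreal pi * indicator {0..} r)"
proof (rule measure_eqI_generator_eq[where E="range (\<lambda>a::real. {..a})" and \<Omega>=UNIV and A="\<lambda>i. {..real i}"])
  show "Int_stable (range (\<lambda>a::real. {..a}))"
    by (auto simp: Int_stable_def)
  show "sets (distr lborel borel (\<lambda>z::complex. (cmod z)\<^sup>2)) = sigma_sets UNIV (range (\<lambda>a::real. {..a}))"
    by (simp add: borel_eq_atMost)
  show "sets (density lborel (\<lambda>r. ennreal pi * indicator {0..} r)) = sigma_sets UNIV (range (\<lambda>a::real. {..a}))"
    by (simp add: borel_eq_atMost)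
  have e: "emeasure (distr lborel borel (\<lambda>z::complex. (cmod z)\<^sup>2)) {..a} = ennreal (pi * max 0 a)" for a
  proof (cases "a \<ge> 0")
    case True
    then have "(\<lambda>z::complex. (cmod z)\<^sup>2) -` {..a} = cball 0 (sqrt a)"
      by (auto simp: real_le_rsqrt sqrt_ge_absD)
    with True show ?thesis
      by (subst emeasure_distr) (auto simp: emeasure_cball unit_ball_vol_2)
  next
    case False
    have "\<not> (cmod z)\<^sup>2 \<le> a" for z using False zero_le_power2[of "cmod z"] by linarith
    then have "(\<lambda>z::complex. (cmod z)\<^sup>2) -` {..a} = {}" by auto
    with False show ?thesis by (subst emeasure_distr) auto
  qed
  have "emeasure (density lborel (\<lambda>r. ennreal pi * indicator {0..} r)) {..a} = ennreal (pi * max 0 a)" for a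
  proof -
    have "emeasure (density lborel (\<lambda>r. ennreal pi * indicator {0..} r)) {..a} =
        (\<integral>\<^sup>+r. ennreal pi * indicator {0..a} r \<partial>lborel)"
      by (subst emeasure_density) (auto intro!: nn_integral_cong simp: indicator_def)
    also have "\<dots> = ennreal (pi * max 0 a)"
      by (subst nn_integral_cmult_indicator) (auto simp: max_def ennreal_mult)
    finally show ?thesis .
  qed
  with e show "X \<in> range (\<lambda>a::real. {..a}) \<Longrightarrow> emeasure (distr lborel borel (\<lambda>z::complex. (cmod z)\<^sup>2)) X =
     emeasure (density lborel (\<lambda>r. ennreal pi * indicator {0..} r)) X" for X by auto
  show "emeasure (distr lborel borel (\<lambda>z::complex. (cmod z)\<^sup>2)) {..real i} \<noteq> \<infinity>" for i
    by (simp add: e)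
  show "(\<Union>i. {..real i}) = UNIV" using real_arch_simple by auto
qed auto

lemma nn_integral_cmod_power2:
  assumes [measurable]: "f \<in> borel_measurable borel"
  shows "(\<integral>\<^sup>+z. f ((cmod z)\<^sup>2) \<partial>lborel) = (\<integral>\<^sup>+r. ennreal pi * (f r * indicator {0..} r) \<partial>lborel)"
proof -
  have "(\<integral>\<^sup>+z. f ((cmod z)\<^sup>2) \<partial>lborel) = (\<integral>\<^sup>+r. f r \<partial>distr lborel borel (\<lambda>z::complex. (cmod z)\<^sup>2))"
    by (simp add: nn_integral_distr)
  then show ?thesis
    by (simp add: distr_lborel_cmod_power2 nn_integral_density ac_simps)
qed

section \<open>The standard complex Gaussian and its unitary invariance\<close>

definition cgauss_density :: "complex \<Rightarrow> real" where
  "cgauss_density z = exp (- (cmod z)\<^sup>2) / pi"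

lemma cgauss_density_nonneg [simp]: "0 \<le> cgauss_density z"
  by (simp add: cgauss_density_def)

lemma measurable_cgauss_density [measurable]: "cgauss_density \<in> borel_measurable borel"
  unfolding cgauss_density_def[abs_def] by measurable

lemma cgauss_eq_density: "cgauss = density lborel (\<lambda>z. ennreal (cgauss_density z))"
  by (simp add: cgauss_def cgauss_density_def)

lemma sets_cgauss [simp, measurable_cong]: "sets cgauss = sets borel"
  and space_cgauss [simp]: "space cgauss = UNIV"
  by (simp_all add: cgauss_def)

lemma nn_integral_cgauss:
  "f \<in> borel_measurable borel \<Longrightarrow> (\<integral>\<^sup>+x. f x \<partial>cgauss) = (\<integral>\<^sup>+x. ennreal (cgauss_density x) * f x \<partial>lborel)"
  unfolding cgauss_eq_density by (subst nn_integral_density) auto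

text \<open>The squared modulus of a standard complex Gaussian is exponential with mean 1: the
  factor pi of the area cancels the normalisation of the density.\<close>

lemma nn_integral_cgauss_cmod_power2:
  assumes [measurable]: "f \<in> borel_measurable borel"
  shows "(\<integral>\<^sup>+z. f ((cmod z)\<^sup>2) \<partial>cgauss) = (\<integral>\<^sup>+r. ennreal (exp (- r)) * f r * indicator {0..} r \<partial>lborel)"
proof -
  have "(\<integral>\<^sup>+z. f ((cmod z)\<^sup>2) \<partial>cgauss) = (\<integral>\<^sup>+z. ennreal (exp (- (cmod z)\<^sup>2) / pi) * f ((cmod z)\<^sup>2) \<partial>lborel)"
    by (subst nn_integral_cgauss) (auto simp: cgauss_density_def)
  also have "\<dots> = (\<integral>\<^sup>+r. ennreal pi * ((ennreal (exp (- r) / pi) * f r) * indicator {0..} r) \<partial>lborel)"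
    by (rule nn_integral_cmod_power2) measurable
  also have "\<dots> = (\<integral>\<^sup>+r. ennreal (exp (- r)) * f r * indicator {0..} r \<partial>lborel)"
  proof (rule nn_integral_cong)
    fix r :: real
    have "ennreal pi * ennreal (exp (- r) / pi) = ennreal (exp (- r))"
      by (simp flip: ennreal_mult)
    then show "ennreal pi * ((ennreal (exp (- r) / pi) * f r) * indicator {0..} r) = ennreal (exp (- r)) * f r * indicator {0..} r"
      by (simp add: mult.assoc[symmetric])
  qed
  finally show ?thesis .
qed

interpretation cgauss: prob_space cgauss
proof
  have "emeasure cgauss (space cgauss) = (\<integral>\<^sup>+z. (\<lambda>_. 1) ((cmod z)\<^sup>2) \<partial>cgauss)" by simp
  also have "\<dots> = (\<integral>\<^sup>+r. ennreal (r^0 * exp (- r)) * indicator {0..} r \<partial>lborel)"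
    by (subst nn_integral_cgauss_cmod_power2) auto
  also have "\<dots> = 1" by (subst nn_intergal_power_times_exp_Ici) auto
  finally show "emeasure cgauss (space cgauss) = 1" .
qed

interpretation cgauss_pair: pair_sigma_finite cgauss cgauss ..

interpretation cgauss_product: product_sigma_finite "\<lambda>_. cgauss" ..

lemma integrable_cgauss_density: "integrable lborel cgauss_density"
proof (rule integrableI_nonneg)
  show "(\<integral>\<^sup>+x. ennreal (cgauss_density x) \<partial>lborel) < \<infinity>"
    using nn_integral_cgauss[of "\<lambda>_. 1"] cgauss.emeasure_space_1 by simp
qed auto

lemma nn_integral_cgauss_cnj:
  assumes [measurable]: "f \<in> borel_measurable borel"
  shows "(\<integral>\<^sup>+x. f (cnj x) \<partial>cgauss) = (\<integral>\<^sup>+x. f x \<partial>cgauss)"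
proof -
  have [measurable]: "cnj \<in> borel_measurable borel"
    by (intro borel_measurable_continuous_onI continuous_intros)
  have "(\<integral>\<^sup>+x. f (cnj x) \<partial>cgauss) = (\<integral>\<^sup>+x. ennreal (cgauss_density (cnj x)) * f (cnj x) \<partial>lborel)"
    by (subst nn_integral_cgauss) (auto simp: cgauss_density_def)
  also have "\<dots> = (\<integral>\<^sup>+x. ennreal (cgauss_density x) * f x \<partial>distr lborel borel cnj)"
    by (subst nn_integral_distr) auto
  finally show ?thesis by (simp add: distr_lborel_cnj nn_integral_cgauss)
qed

text \<open>The unitary map preserves |x|^2 + |y|^2, hence the joint density. Invariance of the
  Lebesgue measure comes from two one-variable substitutions: replacing \<open>x\<close> by
  \<open>u = c x - s y\<close> costs 1/c^2, after which the second argument reads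
  \<open>(cnj s * u + y) / c\<close> and replacing \<open>y\<close> gives c^2 back. A real positive
  \<open>c\<close> makes both substitutions real scalings followed by translations.\<close>

lemma nn_integral_cgauss_rotate:
  fixes c :: real and s :: complex
  assumes [measurable]: "case_prod F \<in> borel_measurable (borel \<Otimes>\<^sub>M borel)"
    and c: "c > 0" "c\<^sup>2 + (cmod s)\<^sup>2 = 1"
  shows "(\<integral>\<^sup>+x. \<integral>\<^sup>+y. F x y \<partial>cgauss \<partial>cgauss) =
    (\<integral>\<^sup>+x. \<integral>\<^sup>+y. F (of_real c * x - s * y) (cnj s * x + of_real c * y) \<partial>cgauss \<partial>cgauss)"
proof -
  have [measurable]: "cnj \<in> borel_measurable borel"
    by (intro borel_measurable_continuous_onI continuous_intros)
  define g where "g u v = ennreal (cgauss_density u) * (ennreal (cgauss_density v) * F u v)" for u v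
  have [measurable]: "case_prod g \<in> borel_measurable (borel \<Otimes>\<^sub>M borel)"
    unfolding g_def[abs_def] by measurable
  have "of_real c * of_real c + s * cnj s = complex_of_real (c\<^sup>2 + (cmod s)\<^sup>2)"
    by (simp only: of_real_add complex_norm_square) (simp add: power2_eq_square)
  then have cs: "s * cnj s = 1 - of_real c * of_real c" using c(2) by (simp add: algebra_simps)
  have nrm: "(cmod (of_real c * x - s * y))\<^sup>2 + (cmod (cnj s * x + of_real c * y))\<^sup>2 = (cmod x)\<^sup>2 + (cmod y)\<^sup>2" for x y :: complex
  proof -
    have "complex_of_real ((cmod (of_real c * x - s * y))\<^sup>2 + (cmod (cnj s * x + of_real c * y))\<^sup>2) =
       (of_real c * of_real c + s * cnj s) * (x * cnj x + y * cnj y)"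
      by (simp add: complex_norm_square del: of_real_power) (simp add: algebra_simps)
    also have "\<dots> = complex_of_real ((cmod x)\<^sup>2 + (cmod y)\<^sup>2)"
      by (simp add: cs complex_norm_square del: of_real_power)
    finally show ?thesis using of_real_eq_iff by blast
  qed
  have "(\<integral>\<^sup>+x. \<integral>\<^sup>+y. F (of_real c * x - s * y) (cnj s * x + of_real c * y) \<partial>cgauss \<partial>cgauss) =
      (\<integral>\<^sup>+x. \<integral>\<^sup>+y. g (of_real c * x - s * y) (cnj s * x + of_real c * y) \<partial>lborel \<partial>lborel)"
  proof -
    have "ennreal (cgauss_density x) * (ennreal (cgauss_density y) * F (of_real c * x - s * y) (cnj s * x + of_real c * y)) =
       g (of_real c * x - s * y) (cnj s * x + of_real c * y)" for x y
    proof -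
      have "cgauss_density x * cgauss_density y = cgauss_density (of_real c * x - s * y) * cgauss_density (cnj s * x + of_real c * y)"
        using nrm[of x y] by (simp add: cgauss_density_def flip: exp_add)
      then show ?thesis unfolding g_def by (simp add: mult.assoc[symmetric] flip: ennreal_mult)
    qed
    then show ?thesis
      by (simp add: nn_integral_cgauss nn_integral_cmult[symmetric])
  qed
  also have "\<dots> = (\<integral>\<^sup>+y. \<integral>\<^sup>+x. g (of_real c * x - s * y) (cnj s * x + of_real c * y) \<partial>lborel \<partial>lborel)"
    by (rule lborel_pair.Fubini') measurable
  also have "\<dots> = (\<integral>\<^sup>+y. ennreal ((1/c)\<^sup>2) * (\<integral>\<^sup>+u. g u ((cnj s * u + y) / of_real c) \<partial>lborel) \<partial>lborel)"
  proof (rule nn_integral_cong)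
    fix y :: complex
    have "of_real c * (s * y / of_real c + of_real (1/c) * u) - s * y = u" for u
      using c(1) by (simp add: field_simps)
    moreover have "cnj s * (s * y / of_real c + of_real (1/c) * u) + of_real c * y = (cnj s * u + y) / of_real c" for u
    proof -
      have "cnj s * (s * y / of_real c + of_real (1/c) * u) + of_real c * y = (s * cnj s * y + cnj s * u + c * of_real c * y) / of_real c"
        using c(1) by (simp add: field_simps)
      also have "\<dots> = (cnj s * u + y) / of_real c" by (simp add: cs algebra_simps)
      finally show ?thesis .
    qed
    ultimately show "(\<integral>\<^sup>+x. g (of_real c * x - s * y) (cnj s * x + of_real c * y) \<partial>lborel) =
        ennreal ((1/c)\<^sup>2) * (\<integral>\<^sup>+u. g u ((cnj s * u + y) / of_real c) \<partial>lborel)"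
      using c(1) by (subst nn_integral_complex_affine[where c="1/c" and t="s * y / of_real c"]) simp_all
  qed
  also have "\<dots> = ennreal ((1/c)\<^sup>2) * (\<integral>\<^sup>+y. \<integral>\<^sup>+u. g u ((cnj s * u + y) / of_real c) \<partial>lborel \<partial>lborel)"
    by (rule nn_integral_cmult) measurable
  also have "(\<integral>\<^sup>+y. \<integral>\<^sup>+u. g u ((cnj s * u + y) / of_real c) \<partial>lborel \<partial>lborel) = (\<integral>\<^sup>+u. \<integral>\<^sup>+y. g u ((cnj s * u + y) / of_real c) \<partial>lborel \<partial>lborel)"
    by (rule lborel_pair.Fubini') measurable
  also have "\<dots> = (\<integral>\<^sup>+u. ennreal (c\<^sup>2) * (\<integral>\<^sup>+v. g u v \<partial>lborel) \<partial>lborel)"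
  proof (rule nn_integral_cong)
    fix u :: complex
    have "(cnj s * u + (- (cnj s * u) + of_real c * v)) / of_real c = v" for v
      using c(1) by simp
    then show "(\<integral>\<^sup>+y. g u ((cnj s * u + y) / of_real c) \<partial>lborel) = ennreal (c\<^sup>2) * (\<integral>\<^sup>+v. g u v \<partial>lborel)"
      using c(1) by (subst nn_integral_complex_affine[where c="c" and t="- (cnj s * u)"]) simp_all
  qed
  also have "\<dots> = ennreal (c\<^sup>2) * (\<integral>\<^sup>+u. \<integral>\<^sup>+v. g u v \<partial>lborel \<partial>lborel)"
    by (rule nn_integral_cmult) measurable
  also have "ennreal ((1/c)\<^sup>2) * \<dots> = (\<integral>\<^sup>+u. \<integral>\<^sup>+v. g u v \<partial>lborel \<partial>lborel)"
    using c(1) by (simp add: mult.assoc[symmetric] power_divide flip: ennreal_mult)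
  also have "\<dots> = (\<integral>\<^sup>+x. \<integral>\<^sup>+y. F x y \<partial>cgauss \<partial>cgauss)"
    by (simp add: g_def nn_integral_cgauss nn_integral_cmult)
  finally show ?thesis by simp
qed

section \<open>Laws of linear combinations of independent complex Gaussians\<close>

lemma measurable_vector_scalar_mult [measurable (raw)]:
  fixes f :: "'a \<Rightarrow> complex" and g :: "'a \<Rightarrow> complex^'n"
  assumes [measurable]: "f \<in> borel_measurable M" "g \<in> borel_measurable M"
  shows "(\<lambda>x. f x *s g x) \<in> borel_measurable M"
proof (rule borel_measurable_continuous_Pair[OF assms])
  show "continuous_on UNIV (\<lambda>x::complex \<times> (complex^'n). fst x *s snd x)"
    unfolding vector_scalar_mult_def by (intro continuous_intros)
qed

text \<open>A centred complex Gaussian vector is encoded by the list of vectors that multiply its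
  independent standard coordinates, rather than by its covariance matrix. Degenerate covariances
  then need no special treatment, and changes of coordinates become operations on the list.\<close>

primrec gauss_law :: "(complex^'n) list \<Rightarrow> (complex^'n) measure" where
  "gauss_law [] = return borel 0"
| "gauss_law (a # as) = distr (cgauss \<Otimes>\<^sub>M gauss_law as) borel (\<lambda>(x, v). x *s a + v)"

lemma sets_gauss_law [simp, measurable_cong]: "sets (gauss_law as) = sets borel"
  by (cases as) simp_all

lemma space_gauss_law [simp]: "space (gauss_law as) = UNIV"
  by (cases as) simp_all

lemma prob_space_gauss_law: "prob_space (gauss_law as)"
proof (induction as)
  case (Cons a as)
  then interpret as: prob_space "gauss_law as" .
  interpret pair_prob_space cgauss "gauss_law as" ..
  show ?case by (simp, rule prob_space_distr) measurable
qed (simp add: prob_space_return)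

lemma nn_integral_gauss_law_Cons:
  assumes [measurable]: "f \<in> borel_measurable borel"
  shows "(\<integral>\<^sup>+v. f v \<partial>gauss_law (a # as)) = (\<integral>\<^sup>+x. \<integral>\<^sup>+v. f (x *s a + v) \<partial>gauss_law as \<partial>cgauss)"
proof -
  interpret as: prob_space "gauss_law as" by (rule prob_space_gauss_law)
  interpret pair_sigma_finite cgauss "gauss_law as" ..
  show ?thesis
    by (simp add: nn_integral_distr as.nn_integral_fst[symmetric])
qed

lemma nn_integral_gauss_law_Nil:
  "f \<in> borel_measurable borel \<Longrightarrow> (\<integral>\<^sup>+v. f v \<partial>gauss_law []) = f 0"
  by (simp add: nn_integral_return)

declare gauss_law.simps [simp del]

lemma gauss_law_eqI:
  assumes "\<And>f. f \<in> borel_measurable borel \<Longrightarrow> (\<integral>\<^sup>+v. f v \<partial>gauss_law as) = (\<integral>\<^sup>+v. f v \<partial>gauss_law bs)"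
  shows "gauss_law as = gauss_law bs"
proof (rule measure_eqI)
  fix A assume "A \<in> sets (gauss_law as)"
  then show "emeasure (gauss_law as) A = emeasure (gauss_law bs) A"
    using assms[of "indicator A"] by (simp add: borel_measurable_indicator)
qed simp

lemma gauss_law_zero:
  fixes as :: "(complex^'n) list"
  shows "gauss_law (0 # as) = gauss_law as"
proof (rule gauss_law_eqI)
  fix f :: "complex^'n \<Rightarrow> ennreal" assume [measurable]: "f \<in> borel_measurable borel"
  show "(\<integral>\<^sup>+v. f v \<partial>gauss_law (0 # as)) = (\<integral>\<^sup>+v. f v \<partial>gauss_law as)"
    by (subst nn_integral_gauss_law_Cons) (auto simp: cgauss.emeasure_space_1[simplified])
qed

lemma nn_integral_gauss_law_Cons2:
  assumes [measurable]: "f \<in> borel_measurable borel"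
  shows "(\<integral>\<^sup>+v. f v \<partial>gauss_law (a # b # as)) =
    (\<integral>\<^sup>+x. \<integral>\<^sup>+y. \<integral>\<^sup>+v. f (x *s a + y *s b + v) \<partial>gauss_law as \<partial>cgauss \<partial>cgauss)"
  by (subst nn_integral_gauss_law_Cons, simp, subst nn_integral_gauss_law_Cons)
    (measurable, simp add: add.assoc)

lemma gauss_law_swap:
  fixes as :: "(complex^'n) list"
  shows "gauss_law (a # b # as) = gauss_law (b # a # as)"
proof (rule gauss_law_eqI)
  fix f :: "complex^'n \<Rightarrow> ennreal" assume [measurable]: "f \<in> borel_measurable borel"
  interpret as: prob_space "gauss_law as" by (rule prob_space_gauss_law)
  show "(\<integral>\<^sup>+v. f v \<partial>gauss_law (a # b # as)) = (\<integral>\<^sup>+v. f v \<partial>gauss_law (b # a # as))"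
    unfolding nn_integral_gauss_law_Cons2[OF \<open>f \<in> _\<close>]
    by (subst cgauss_pair.Fubini') (measurable, simp add: ac_simps)
qed

text \<open>Rotating the two Gaussian coefficients and collecting the terms of \<open>x\<close> and
  of \<open>y\<close> applies the corresponding unitary mixing to the two vectors.\<close>

lemma gauss_law_rotate:
  fixes c :: real and as :: "(complex^'n) list"
  assumes "c > 0" "c\<^sup>2 + (cmod s)\<^sup>2 = 1"
  shows "gauss_law (a # b # as) =
    gauss_law ((of_real c *s a + cnj s *s b) # (of_real c *s b - s *s a) # as)"
proof (rule gauss_law_eqI)
  fix f :: "complex^'n \<Rightarrow> ennreal" assume f [measurable]: "f \<in> borel_measurable borel"
  interpret as: prob_space "gauss_law as" by (rule prob_space_gauss_law)
  have eq: "(of_real c * x - s * y) *s a + (cnj s * x + of_real c * y) *s b =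
    x *s (of_real c *s a + cnj s *s b) + y *s (of_real c *s b - s *s a)" for x y
    by (simp add: vec_eq_iff algebra_simps)
  show "(\<integral>\<^sup>+v. f v \<partial>gauss_law (a # b # as)) =
     (\<integral>\<^sup>+v. f v \<partial>gauss_law ((of_real c *s a + cnj s *s b) # (of_real c *s b - s *s a) # as))"
    unfolding nn_integral_gauss_law_Cons2[OF f]
    by (subst nn_integral_cgauss_rotate[OF _ assms]) (measurable, simp only: eq)
qed

section \<open>Covariance matrices and reduction to triangular form\<close>

definition gram :: "(complex^'n) list \<Rightarrow> 'n \<Rightarrow> 'n \<Rightarrow> complex" where
  "gram as i j = (\<Sum>a\<leftarrow>as. a $ i * cnj (a $ j))"

lemma gram_simps [simp]: "gram [] i j = 0" "gram (a # as) i j = a $ i * cnj (a $ j) + gram as i j"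
  by (simp_all add: gram_def)

text \<open>This is a Givens rotation that clears coordinate \<open>i\<close> of the second vector,
  or a swap if that coordinate of the first vector is already zero. A unitary mixing preserves the
  sum of the rank-one matrices, hence the covariance. The last clause guarantees that later
  eliminations do not destroy zeros obtained earlier.\<close>

lemma gauss_law_eliminate:
  fixes a b :: "complex^'n" and i :: 'n
  obtains a' b' where "b' $ i = 0" "\<And>as. gauss_law (a # b # as) = gauss_law (a' # b' # as)"
    "\<And>k l. gram [a, b] k l = gram [a', b'] k l"
    "\<And>j. a $ j = 0 \<Longrightarrow> b $ j = 0 \<Longrightarrow> a' $ j = 0 \<and> b' $ j = 0"
proof (cases "a $ i = 0")
  case True
  then show ?thesis by (intro that[of a b, OF _ gauss_law_swap]) (auto intro: gauss_law_swap)
next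
  case False
  \<comment> \<open>The coordinate to be cleared becomes \<open>c * b $ i - s * a $ i\<close>, so
    \<open>s / c\<close> must be the ratio \<open>q\<close>; then \<open>c\<close> is fixed by the
    normalisation c^2 + |s|^2 = 1.\<close>
  define q where "q = b $ i / a $ i"
  define c where "c = 1 / sqrt (1 + (cmod q)\<^sup>2)"
  define s where "s = of_real c * q"
  have c: "c > 0" unfolding c_def by (simp add: add_pos_nonneg)
  have c2: "c\<^sup>2 * (1 + (cmod q)\<^sup>2) = 1"
    unfolding c_def power_divide using add_pos_nonneg[of 1 "(cmod q)\<^sup>2"] by simp
  have cs: "c\<^sup>2 + (cmod s)\<^sup>2 = 1"
    using c2 c by (simp add: s_def norm_mult power_mult_distrib algebra_simps)
  have "of_real c * of_real c + s * cnj s = complex_of_real (c\<^sup>2 + (cmod s)\<^sup>2)"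
    by (simp only: of_real_add complex_norm_square) (simp add: power2_eq_square)
  then have ccs: "of_real c * of_real c = 1 - s * cnj s" using cs by (simp add: algebra_simps)
  show ?thesis
  proof (rule that[of "of_real c *s b - s *s a" "of_real c *s a + cnj s *s b"])
    show "(of_real c *s b - s *s a) $ i = 0" using False by (simp add: s_def q_def)
    show "gauss_law (a # b # as) = gauss_law ((of_real c *s a + cnj s *s b) # (of_real c *s b - s *s a) # as)" for as
      by (rule gauss_law_rotate[OF c cs])
    show "gram [a, b] k l = gram [of_real c *s a + cnj s *s b, of_real c *s b - s *s a] k l" for k l
    proof -
      have "gram [of_real c *s a + cnj s *s b, of_real c *s b - s *s a] k l =
        (of_real c * of_real c) * (a $ k * cnj (a $ l) + b $ k * cnj (b $ l)) +
        (s * cnj s) * (a $ k * cnj (a $ l) + b $ k * cnj (b $ l))"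
        by (simp add: algebra_simps)
      then show ?thesis by (simp add: ccs algebra_simps)
    qed
  qed auto
qed

text \<open>Each new vector is passed through \<open>p\<close>, \<open>q\<close> and
  \<open>r\<close>, losing its first, second and third coordinate in turn. What remains is the zero
  vector, which does not change the law and is dropped. This is a probabilistic Cholesky
  factorisation: however many coefficients there are, three standard Gaussians suffice, and the
  entries are governed by the Gram matrix.\<close>

lemma gauss_law_triangular:
  fixes as :: "(complex^3) list"
  obtains p q r where "gauss_law as = gauss_law [p, q, r]" "\<And>k l. gram as k l = gram [p, q, r] k l"
    "q $ 1 = 0" "r $ 1 = 0" "r $ 2 = 0"
proof -
  have "\<exists>p q r. gauss_law as = gauss_law [p, q, r] \<and> (\<forall>k l. gram as k l = gram [p, q, r] k l) \<and>
    q $ 1 = 0 \<and> r $ 1 = 0 \<and> r $ 2 = 0"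
  proof (induction as)
    case Nil
    show ?case by (intro exI[of _ 0]) (simp only: gauss_law_zero, simp)
  next
    case (Cons a as)
    then obtain p q r where 0: "gauss_law as = gauss_law [p, q, r]" "\<And>k l. gram as k l = gram [p, q, r] k l"
      "q $ 1 = 0" "r $ 1 = 0" "r $ 2 = 0" by blast
    obtain p' a1 where 1: "a1 $ 1 = 0" "\<And>as. gauss_law (p # a # as) = gauss_law (p' # a1 # as)"
      "\<And>k l. gram [p, a] k l = gram [p', a1] k l"
      by (rule gauss_law_eliminate[of 1 p a]) blast
    obtain q' a2 where 2: "a2 $ 2 = 0" "\<And>as. gauss_law (q # a1 # as) = gauss_law (q' # a2 # as)"
      "\<And>k l. gram [q, a1] k l = gram [q', a2] k l" "\<And>j. q $ j = 0 \<Longrightarrow> a1 $ j = 0 \<Longrightarrow> q' $ j = 0 \<and> a2 $ j = 0"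
      by (rule gauss_law_eliminate[of 2 q a1]) blast
    obtain r' a3 where 3: "a3 $ 3 = 0" "\<And>as. gauss_law (r # a2 # as) = gauss_law (r' # a3 # as)"
      "\<And>k l. gram [r, a2] k l = gram [r', a3] k l" "\<And>j. r $ j = 0 \<Longrightarrow> a2 $ j = 0 \<Longrightarrow> r' $ j = 0 \<and> a3 $ j = 0"
      by (rule gauss_law_eliminate[of 3 r a2]) blast
    have z: "q' $ 1 = 0" "a2 $ 1 = 0" using 2(4)[of 1] 0(3) 1(1) by auto
    have z': "r' $ 1 = 0" "a3 $ 1 = 0" "r' $ 2 = 0" "a3 $ 2 = 0"
      using 3(4)[of 1] 3(4)[of 2] 0(4,5) z(2) 2(1) by auto
    have a3: "a3 = 0" using z' 3(1) by (simp add: vec_eq_iff forall_3)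
    \<comment> \<open>Rotations act on the two leading vectors, so swaps bring the travelling vector
      next to its partner. Unfolding one \<open>Cons\<close> allows the tail to be replaced by any
      list with the same law.\<close>
    have "gauss_law (a # as) = gauss_law (p # a # [q, r])"
      using 0(1) gauss_law_swap[of p a "[q, r]"] by (simp add: gauss_law.simps(2)[of a])
    also have "\<dots> = gauss_law (p' # a1 # q # [r])" using 1(2) by simp
    also have "\<dots> = gauss_law (p' # q # a1 # [r])" using gauss_law_swap[of a1 q "[r]"] by (simp add: gauss_law.simps(2)[of p'])
    also have "\<dots> = gauss_law (p' # q' # a2 # r # [])" using 2(2)[of "[r]"] by (simp add: gauss_law.simps(2)[of p'])
    also have "\<dots> = gauss_law (p' # q' # r # a2 # [])" using gauss_law_swap[of a2 r "[]"] by (simp add: gauss_law.simps(2)[of p'] gauss_law.simps(2)[of q'])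
    also have "\<dots> = gauss_law (p' # q' # r' # a3 # [])" using 3(2)[of "[]"] by (simp add: gauss_law.simps(2)[of p'] gauss_law.simps(2)[of q'])
    also have "\<dots> = gauss_law (p' # q' # a3 # r' # [])" using gauss_law_swap[of a3 r' "[]"] by (simp add: gauss_law.simps(2)[of p'] gauss_law.simps(2)[of q'])
    also have "\<dots> = gauss_law [p', q', r']" using gauss_law_zero[of "[r']"] by (simp add: a3 gauss_law.simps(2)[of p'] gauss_law.simps(2)[of q'])
    finally have "gauss_law (a # as) = gauss_law [p', q', r']" .
    moreover have "gram (a # as) k l = gram [p', q', r'] k l" for k l
      using 0(2)[of k l] 1(3)[of k l] 2(3)[of k l] 3(3)[of k l] by (simp add: a3 algebra_simps) algebra
    ultimately show ?case using z z' by blast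
  qed
  then show ?thesis using that by blast
qed

lemma nn_integral_gauss_law_append:
  fixes as bs :: "(complex^'n) list"
  assumes "f \<in> borel_measurable borel"
  shows "(\<integral>\<^sup>+v. f v \<partial>gauss_law (as @ bs)) = (\<integral>\<^sup>+u. \<integral>\<^sup>+v. f (u + v) \<partial>gauss_law bs \<partial>gauss_law as)"
  using assms
proof (induction as arbitrary: f)
  case (Nil f)
  interpret bs: prob_space "gauss_law bs" by (rule prob_space_gauss_law)
  note [measurable] = Nil
  show ?case by (subst nn_integral_gauss_law_Nil) auto
next
  case (Cons a as f)
  note [measurable] = Cons.prems
  interpret bs: prob_space "gauss_law bs" by (rule prob_space_gauss_law)
  show ?case
    by (subst nn_integral_gauss_law_Cons, measurable)
      (simp add: nn_integral_gauss_law_Cons Cons.IH add.assoc)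
qed

text \<open>The map \<open>h\<close> stands for the identity or the conjugation, which serve the
  analytic and the anti-analytic half of H. Only the invariance of the standard Gaussian under
  \<open>h\<close> matters.\<close>

lemma nn_integral_PiM_gauss_law:
  fixes a :: "'i \<Rightarrow> complex^'n"
  assumes "f \<in> borel_measurable borel" "distinct xs"
    and h [measurable]: "h \<in> borel_measurable borel"
    and inv: "\<And>f. f \<in> borel_measurable borel \<Longrightarrow> (\<integral>\<^sup>+x. f (h x) \<partial>cgauss) = (\<integral>\<^sup>+x. f x \<partial>cgauss)"
  shows "(\<integral>\<^sup>+\<omega>. f (\<Sum>k\<in>set xs. h (\<omega> k) *s a k) \<partial>PiM (set xs) (\<lambda>_. cgauss)) = (\<integral>\<^sup>+v. f v \<partial>gauss_law (map a xs))"
  using assms(1,2)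
proof (induction xs arbitrary: f)
  case (Nil f)
  then show ?case by (simp add: nn_integral_gauss_law_Nil PiM_empty nn_integral_count_space_finite)
next
  case (Cons x xs f)
  note [measurable] = Cons.prems(1)
  have x: "x \<notin> set xs" using Cons.prems by simp
  interpret as: prob_space "gauss_law (map a xs)" by (rule prob_space_gauss_law)
  have "(\<integral>\<^sup>+\<omega>. f (\<Sum>k\<in>set (x # xs). h (\<omega> k) *s a k) \<partial>PiM (set (x # xs)) (\<lambda>_. cgauss)) =
      (\<integral>\<^sup>+\<omega>. f (h (\<omega> x) *s a x + (\<Sum>k\<in>set xs. h (\<omega> k) *s a k)) \<partial>PiM (insert x (set xs)) (\<lambda>_. cgauss))"
    using x by simp
  also have "\<dots> = (\<integral>\<^sup>+y. \<integral>\<^sup>+\<omega>. f (h ((fun_upd \<omega> x y) x) *s a x + (\<Sum>k\<in>set xs. h ((fun_upd \<omega> x y) k) *s a k)) \<partial>PiM (set xs) (\<lambda>_. cgauss) \<partial>cgauss)"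
    by (subst cgauss_product.product_nn_integral_insert_rev[OF _ x]) (auto intro!: measurable_compose[OF _ Cons.prems(1)])
  also have "\<dots> = (\<integral>\<^sup>+y. \<integral>\<^sup>+\<omega>. f (h y *s a x + (\<Sum>k\<in>set xs. h (\<omega> k) *s a k)) \<partial>PiM (set xs) (\<lambda>_. cgauss) \<partial>cgauss)"
  proof -
    have "(\<Sum>k\<in>set xs. h ((fun_upd \<omega> x y) k) *s a k) = (\<Sum>k\<in>set xs. h (\<omega> k) *s a k)" for \<omega> y
      using x by (intro sum.cong) auto
    then show ?thesis by (simp add: fun_upd_same)
  qed
  also have "\<dots> = (\<integral>\<^sup>+y. \<integral>\<^sup>+v. f (h y *s a x + v) \<partial>gauss_law (map a xs) \<partial>cgauss)"
    using Cons.prems(2) by (intro nn_integral_cong Cons.IH) auto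
  also have "\<dots> = (\<integral>\<^sup>+y. \<integral>\<^sup>+v. f (y *s a x + v) \<partial>gauss_law (map a xs) \<partial>cgauss)"
    by (rule inv) measurable
  also have "\<dots> = (\<integral>\<^sup>+v. f v \<partial>gauss_law (map a (x # xs)))"
    by (simp add: nn_integral_gauss_law_Cons)
  finally show ?case .
qed

text \<open>The product of the densities at \<open>x\<close> and at \<open>x * h\<close> is
  proportional to exp(-(1 + |h|^2) |x|^2), again a Gaussian, shrunk by 1/\<kappa>. This is the
  conditioning step: \<open>h\<close> will be the coefficient of this variable in H - A_0, and the
  tilting factor is the density of A_0.\<close>

lemma nn_integral_cgauss_tilt:
  fixes h :: complex
  assumes [measurable]: "g \<in> borel_measurable borel"
  defines "\<kappa> \<equiv> sqrt (1 + (cmod h)\<^sup>2)"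
  shows "(\<integral>\<^sup>+x. ennreal (cgauss_density (x * h)) * g x \<partial>cgauss) =
    ennreal (1 / (pi * \<kappa>\<^sup>2)) * (\<integral>\<^sup>+x. g (of_real (1/\<kappa>) * x) \<partial>cgauss)"
proof -
  have \<kappa>: "\<kappa> > 0" "\<kappa>\<^sup>2 = 1 + (cmod h)\<^sup>2" unfolding \<kappa>_def by (simp_all add: add_pos_nonneg)
  have "(\<integral>\<^sup>+x. ennreal (cgauss_density (x * h)) * g x \<partial>cgauss) =
      (\<integral>\<^sup>+x. ennreal (cgauss_density x) * (ennreal (cgauss_density (x * h)) * g x) \<partial>lborel)"
    by (rule nn_integral_cgauss) measurable
  also have "\<dots> = (\<integral>\<^sup>+x. ennreal (1/pi) * (ennreal (cgauss_density (of_real \<kappa> * x)) * g x) \<partial>lborel)"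
  proof (rule nn_integral_cong)
    fix x :: complex
    have "cgauss_density x * cgauss_density (x * h) = 1/pi * cgauss_density (of_real \<kappa> * x)"
      using \<kappa> by (simp add: cgauss_density_def norm_mult power_mult_distrib algebra_simps flip: exp_add)
    then show "ennreal (cgauss_density x) * (ennreal (cgauss_density (x * h)) * g x) =
        ennreal (1/pi) * (ennreal (cgauss_density (of_real \<kappa> * x)) * g x)"
      by (simp add: mult.assoc[symmetric] flip: ennreal_mult)
  qed
  also have "\<dots> = ennreal (1/pi) * (\<integral>\<^sup>+x. ennreal (cgauss_density (of_real \<kappa> * x)) * g x \<partial>lborel)"
    by (rule nn_integral_cmult) measurable
  also have "(\<integral>\<^sup>+x. ennreal (cgauss_density (of_real \<kappa> * x)) * g x \<partial>lborel) =
      ennreal ((1/\<kappa>)\<^sup>2) * (\<integral>\<^sup>+x. ennreal (cgauss_density x) * g (of_real (1/\<kappa>) * x) \<partial>lborel)"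
    using \<kappa>(1) by (subst nn_integral_complex_affine[where c="1/\<kappa>" and t=0]) simp_all
  also have "(\<integral>\<^sup>+x. ennreal (cgauss_density x) * g (of_real (1/\<kappa>) * x) \<partial>lborel) = (\<integral>\<^sup>+x. g (of_real (1/\<kappa>) * x) \<partial>cgauss)"
    by (rule nn_integral_cgauss[symmetric]) measurable
  finally show ?thesis using \<kappa>(1) by (simp add: mult.assoc[symmetric] power_divide flip: ennreal_mult)
qed

section \<open>Mean absolute value of an indefinite Hermitian form\<close>

lemma nn_integral_abs_diff_exp:
  assumes "0 \<le> r"
  shows "(\<integral>\<^sup>+u. ennreal (exp (- u)) * ennreal \<bar>r - u\<bar> * indicator {0..} u \<partial>lborel) = ennreal (r - 1 + 2 * exp (- r))"
proof -
  have "(\<integral>\<^sup>+u. ennreal (exp (- u)) * ennreal \<bar>r - u\<bar> * indicator {0..} u \<partial>lborel) =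
     (\<integral>\<^sup>+u. ennreal ((r - u) * exp (- u)) * indicator {0..r} u + ennreal ((u - r) * exp (- u)) * indicator {r..} u \<partial>lborel)"
    using assms by (intro nn_integral_cong) (auto simp: indicator_def abs_if mult.commute simp flip: ennreal_mult)
  also have "\<dots> = (\<integral>\<^sup>+u. ennreal ((r - u) * exp (- u)) * indicator {0..r} u \<partial>lborel) +
      (\<integral>\<^sup>+u. ennreal ((u - r) * exp (- u)) * indicator {r..} u \<partial>lborel)"
    by (rule nn_integral_add) measurable
  also have "(\<integral>\<^sup>+u. ennreal ((r - u) * exp (- u)) * indicator {0..r} u \<partial>lborel) =
      ennreal ((r - r + 1) * exp (- r) - (0 - r + 1) * exp (- 0))"
    by (rule nn_integral_FTC_Icc[where F="\<lambda>u. (u - r + 1) * exp (- u)"])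
      (auto intro!: derivative_eq_intros simp: algebra_simps assms)
  also have "(\<integral>\<^sup>+u. ennreal ((u - r) * exp (- u)) * indicator {r..} u \<partial>lborel) =
      ennreal (0 - (- (r - r + 1) * exp (- r)))"
  proof (rule nn_integral_FTC_atLeast[where F="\<lambda>u. - (u - r + 1) * exp (- u)"])
    show "((\<lambda>u. - (u - r + 1) * exp (- u)) \<longlongrightarrow> 0) at_top" by real_asymp
  qed (auto intro!: derivative_eq_intros simp: algebra_simps)
  also have "ennreal ((r - r + 1) * exp (- r) - (0 - r + 1) * exp (- 0)) + \<dots> = ennreal (r - 1 + 2 * exp (- r))"
    using exp_ge_add_one_self[of "- r"] by (subst ennreal_plus[symmetric]) (auto simp: algebra_simps)
  finally show ?thesis .
qed

text \<open>The two squared moduli are independent exponentials with mean 1, so their difference is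
  a Laplace variable. Conditionally on the first one being r, the mean is r - 1 + 2 exp(-r), which
  integrates to 1 against exp(-r).\<close>

lemma nn_integral_abs_diff_cgauss:
  "(\<integral>\<^sup>+x. \<integral>\<^sup>+y. ennreal \<bar>(cmod x)\<^sup>2 - (cmod y)\<^sup>2\<bar> \<partial>cgauss \<partial>cgauss) = 1"
proof -
  have "(\<integral>\<^sup>+x. \<integral>\<^sup>+y. ennreal \<bar>(cmod x)\<^sup>2 - (cmod y)\<^sup>2\<bar> \<partial>cgauss \<partial>cgauss) =
    (\<integral>\<^sup>+x. (\<lambda>r. ennreal (r - 1 + 2 * exp (- r))) ((cmod x)\<^sup>2) \<partial>cgauss)"
  proof (rule nn_integral_cong)
    fix x :: complex
    show "(\<integral>\<^sup>+y. ennreal \<bar>(cmod x)\<^sup>2 - (cmod y)\<^sup>2\<bar> \<partial>cgauss) = ennreal ((cmod x)\<^sup>2 - 1 + 2 * exp (- (cmod x)\<^sup>2))"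
      using nn_integral_cgauss_cmod_power2[of "\<lambda>u. ennreal \<bar>(cmod x)\<^sup>2 - u\<bar>"]
      by (simp add: nn_integral_abs_diff_exp)
  qed
  also have "\<dots> = (\<integral>\<^sup>+r. ennreal (exp (- r)) * ennreal (r - 1 + 2 * exp (- r)) * indicator {0..} r \<partial>lborel)"
    by (rule nn_integral_cgauss_cmod_power2) measurable
  also have "\<dots> = (\<integral>\<^sup>+r. ennreal (exp (- r) * (r - 1 + 2 * exp (- r))) * indicator {0..} r \<partial>lborel)"
    by (simp add: ennreal_mult')
  also have "\<dots> = ennreal (0 - (- 0 * exp (- 0) - exp (- 2 * 0)))"
  proof (rule nn_integral_FTC_atLeast[where F="\<lambda>r. - r * exp (- r) - exp (- 2 * r)"])
    show "((\<lambda>r::real. - r * exp (- r) - exp (- 2 * r)) \<longlongrightarrow> 0) at_top" by real_asymp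
    fix r :: real assume "0 \<le> r"
    have "1 - r \<le> exp (- r)" using exp_ge_add_one_self[of "- r"] by simp
    then have "0 \<le> r - 1 + 2 * exp (- r)" using exp_gt_zero[of "- r"] by linarith
    then show "0 \<le> exp (- r) * (r - 1 + 2 * exp (- r))" by simp
    have "exp (- 2 * r) = exp (- r) * exp (- r)" by (simp flip: exp_add)
    then show "((\<lambda>r. - r * exp (- r) - exp (- 2 * r)) has_real_derivative exp (- r) * (r - 1 + 2 * exp (- r))) (at r)"
      by (auto intro!: derivative_eq_intros simp: algebra_simps)
  qed measurable
  finally show ?thesis by simp
qed

lemma nn_integral_gauss_law_map:
  fixes L :: "complex^'n \<Rightarrow> complex^'m"
  assumes "f \<in> borel_measurable borel" and L [measurable]: "L \<in> borel_measurable borel"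
    and lin: "\<And>x a v. L (x *s a + v) = x *s L a + L v" "L 0 = 0"
  shows "(\<integral>\<^sup>+v. f (L v) \<partial>gauss_law as) = (\<integral>\<^sup>+v. f v \<partial>gauss_law (map L as))"
  using assms(1)
proof (induction as arbitrary: f)
  case (Nil f)
  note [measurable] = Nil
  show ?case by (simp add: nn_integral_gauss_law_Nil lin)
next
  case (Cons a as f)
  note [measurable] = Cons.prems
  have "(\<integral>\<^sup>+v. f (L v) \<partial>gauss_law (a # as)) = (\<integral>\<^sup>+x. \<integral>\<^sup>+v. f (x *s L a + L v) \<partial>gauss_law as \<partial>cgauss)"
    by (simp add: nn_integral_gauss_law_Cons lin)
  also have "\<dots> = (\<integral>\<^sup>+x. \<integral>\<^sup>+v. f (x *s L a + v) \<partial>gauss_law (map L as) \<partial>cgauss)"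
    by (intro nn_integral_cong Cons.IH) measurable
  finally show ?case by (simp add: nn_integral_gauss_law_Cons)
qed

text \<open>The hypothesis says that the Hermitian form in (x, y) has trace zero, so its eigenvalues
  are l and -l with l^2 equal to minus the determinant, that is |s|^2 |w|^2. A unitary change to
  eigenvectors, harmless for independent standard Gaussians, turns the form into l (|x|^2 - |y|^2),
  whose mean absolute value is l.\<close>

lemma cgauss_expectation_abs_indefinite_form:
  fixes s t w :: complex
  assumes s: "(cmod s)\<^sup>2 = (cmod t)\<^sup>2 + (cmod w)\<^sup>2"
  shows "(\<integral>\<^sup>+x. \<integral>\<^sup>+y. ennreal \<bar>(cmod (x * s))\<^sup>2 - (cmod (x * t + y * w))\<^sup>2\<bar> \<partial>cgauss \<partial>cgauss) =
    ennreal (cmod s * cmod w)"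
proof (cases "w = 0")
  case True
  with s show ?thesis by (simp add: norm_mult)
next
  case False
  define m where "m = (cmod w)\<^sup>2"
  define l where "l = cmod s * cmod w"
  define \<tau> where "\<tau> = t * cnj w"
  \<comment> \<open>In the basis (x, y) the form has diagonal entries m, -m and off-diagonal entry
    -\<tau>. The vector (l + m, -\<tau>) is an eigenvector for l, and \<open>N\<close> is its norm:
    (l + m)^2 + |\<tau>|^2 = 2 l (l + m) because l^2 = m^2 + |\<tau>|^2.\<close>
  define N where "N = sqrt (2 * l * (l + m))"
  have m: "m > 0" using False by (simp add: m_def)
  have "(cmod s)\<^sup>2 > 0" using m zero_le_power2[of "cmod t"] by (simp add: s m_def add_nonneg_pos)
  then have l: "l > 0" using False by (simp add: l_def)
  have N: "N > 0" "N\<^sup>2 = 2 * l * (l + m)" using l m by (simp_all add: N_def)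
  have l2: "l\<^sup>2 = m\<^sup>2 + (cmod \<tau>)\<^sup>2"
    by (simp add: l_def power_mult_distrib s m_def \<tau>_def norm_mult algebra_simps)
  define c where "c = (l + m) / N"
  define \<sigma> where "\<sigma> = - cnj \<tau> / of_real N"
  have c: "c > 0" using l m N(1) by (simp add: c_def)
  have "N\<^sup>2 = (l + m)\<^sup>2 + (cmod \<tau>)\<^sup>2" using l2 N(2) by (simp add: power2_eq_square algebra_simps)
  then have cs: "c\<^sup>2 + (cmod \<sigma>)\<^sup>2 = 1"
    using N(1) l m by (simp add: c_def \<sigma>_def norm_divide power_divide flip: add_divide_distrib)
  have form: "(cmod (x * s))\<^sup>2 - (cmod (x * t + y * w))\<^sup>2 =
      m * ((cmod x)\<^sup>2 - (cmod y)\<^sup>2) - 2 * Re (\<tau> * x * cnj y)" for x y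
  proof -
    have "(cmod (a + b))\<^sup>2 = (cmod a)\<^sup>2 + (cmod b)\<^sup>2 + 2 * Re (a * cnj b)" for a b
      unfolding cmod_power2 by (simp add: power2_eq_square algebra_simps)
    from this[of "x * t" "y * w"] show ?thesis
      by (simp add: norm_mult power_mult_distrib s m_def \<tau>_def algebra_simps)
  qed
  have diag: "(cmod ((of_real c * x - \<sigma> * y) * s))\<^sup>2 - (cmod ((of_real c * x - \<sigma> * y) * t + (cnj \<sigma> * x + of_real c * y) * w))\<^sup>2 =
      l * ((cmod x)\<^sup>2 - (cmod y)\<^sup>2)" for x y
  proof -
    define X where "X = of_real (l + m) * x + cnj \<tau> * y"
    define Y where "Y = of_real (l + m) * y - \<tau> * x"
    have XY: "of_real c * x - \<sigma> * y = X / of_real N" "cnj \<sigma> * x + of_real c * y = Y / of_real N"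
      by (simp_all add: X_def Y_def c_def \<sigma>_def add_divide_distrib diff_divide_distrib distrib_right)
    have T: "\<tau> * cnj \<tau> = of_real l * of_real l - of_real m * of_real m"
    proof -
      have "\<tau> * cnj \<tau> = complex_of_real (l\<^sup>2 - m\<^sup>2)" using l2 by (simp flip: complex_norm_square)
      then show ?thesis by (simp add: power2_eq_square)
    qed
    have re: "of_real (2 * Re z) = z + cnj z" for z by (simp add: complex_eq_iff)
    have "complex_of_real (m * ((cmod X)\<^sup>2 - (cmod Y)\<^sup>2) - 2 * Re (\<tau> * X * cnj Y)) =
        of_real m * (X * cnj X - Y * cnj Y) - (\<tau> * X * cnj Y + cnj \<tau> * cnj X * Y)"
      unfolding of_real_diff of_real_mult[of m] complex_norm_square re by simp
    also have "\<dots> = 2 * of_real l * of_real l * (of_real l + of_real m) * (x * cnj x - y * cnj y)"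
    proof -
      \<comment> \<open>The mixed terms carry the factor 2 m k - (k^2 - |\<tau>|^2), which is zero
        by \<open>kT\<close>. This is the vanishing of the off-diagonal entry in the
        eigenbasis.\<close>
      define k where "k = complex_of_real (l + m)"
      have kT: "k * k - \<tau> * cnj \<tau> = 2 * of_real m * k"
        unfolding T k_def by (simp add: algebra_simps)
      have "of_real m * (X * cnj X - Y * cnj Y) - (\<tau> * X * cnj Y + cnj \<tau> * cnj X * Y) =
        (of_real m * (k * k - \<tau> * cnj \<tau>) + 2 * k * (\<tau> * cnj \<tau>)) * (x * cnj x - y * cnj y) +
        (2 * of_real m * k - (k * k - \<tau> * cnj \<tau>)) * (\<tau> * x * cnj y + cnj \<tau> * cnj x * y)"
        unfolding X_def Y_def k_def[symmetric] by (simp add: k_def algebra_simps)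
      then show ?thesis unfolding kT T by (simp add: k_def algebra_simps)
    qed
    also have "\<dots> = of_real (N\<^sup>2 * (l * ((cmod x)\<^sup>2 - (cmod y)\<^sup>2)))"
      unfolding N(2) of_real_diff of_real_mult complex_norm_square by simp
    finally have E: "m * ((cmod X)\<^sup>2 - (cmod Y)\<^sup>2) - 2 * Re (\<tau> * X * cnj Y) = N\<^sup>2 * (l * ((cmod x)\<^sup>2 - (cmod y)\<^sup>2))"
      by (simp only: of_real_eq_iff)
    have "\<tau> * (X / of_real N) * cnj (Y / of_real N) = of_real (1 / N\<^sup>2) * (\<tau> * X * cnj Y)"
      by (simp add: power2_eq_square)
    then have R: "Re (\<tau> * (X / of_real N) * cnj (Y / of_real N)) = Re (\<tau> * X * cnj Y) / N\<^sup>2"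
      by (simp only: Re_complex_of_real mult.commute[of "of_real _"]) (simp add: Re_divide_of_real)
    have M: "(cmod (X / of_real N))\<^sup>2 = (cmod X)\<^sup>2 / N\<^sup>2" "(cmod (Y / of_real N))\<^sup>2 = (cmod Y)\<^sup>2 / N\<^sup>2"
      by (simp_all add: norm_divide power_divide)
    have D: "m * (u / N\<^sup>2 - v / N\<^sup>2) - 2 * (w / N\<^sup>2) = (m * (u - v) - 2 * w) / N\<^sup>2" for u v w
      by (simp add: algebra_simps diff_divide_distrib add_divide_distrib)
    show ?thesis unfolding form XY R M D E using N(1) by simp
  qed
  have "(\<integral>\<^sup>+x. \<integral>\<^sup>+y. ennreal \<bar>(cmod (x * s))\<^sup>2 - (cmod (x * t + y * w))\<^sup>2\<bar> \<partial>cgauss \<partial>cgauss) =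
     (\<integral>\<^sup>+x. \<integral>\<^sup>+y. ennreal \<bar>l * ((cmod x)\<^sup>2 - (cmod y)\<^sup>2)\<bar> \<partial>cgauss \<partial>cgauss)"
    by (subst nn_integral_cgauss_rotate[OF _ c cs]) (measurable, simp only: diag)
  also have "\<dots> = (\<integral>\<^sup>+x. \<integral>\<^sup>+y. ennreal l * ennreal \<bar>(cmod x)\<^sup>2 - (cmod y)\<^sup>2\<bar> \<partial>cgauss \<partial>cgauss)"
    using l by (simp add: abs_mult ennreal_mult)
  also have "\<dots> = ennreal l"
    by (simp add: nn_integral_cmult nn_integral_abs_diff_cgauss)
  finally show ?thesis by (simp add: l_def)
qed

lemma nn_integral_gauss_law_3:
  assumes [measurable]: "f \<in> borel_measurable borel"
  shows "(\<integral>\<^sup>+v. f v \<partial>gauss_law [p, q, r]) =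
    (\<integral>\<^sup>+x. \<integral>\<^sup>+y. \<integral>\<^sup>+z. f (x *s p + (y *s q + z *s r)) \<partial>cgauss \<partial>cgauss \<partial>cgauss)"
  by (simp add: nn_integral_gauss_law_Cons nn_integral_gauss_law_Nil)

text \<open>Conditioning the first coordinate of the Gaussian vector to vanish subtracts the
  rank-one term from its covariance; the remaining pair is reduced to triangular form again.\<close>
lemma gauss_law_conditional_abs_Jacobian:
  fixes as :: "(complex^3) list" and h c b2 :: real
  assumes g: "gram as 1 1 = of_real h" "gram as 2 2 = of_real c" "gram as 3 3 = of_real c" "gram as 3 2 = 0"
    and b: "(cmod (gram as 2 1))\<^sup>2 = b2" "(cmod (gram as 3 1))\<^sup>2 = b2"
  defines "\<beta> \<equiv> b2 / (1 + h)"
  shows "(\<integral>\<^sup>+v. ennreal (cgauss_density (v $ 1)) * ennreal \<bar>(cmod (v $ 2))\<^sup>2 - (cmod (v $ 3))\<^sup>2\<bar> \<partial>gauss_law as) =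
    ennreal (1 / (pi * (1 + h)) * sqrt ((c - \<beta>)\<^sup>2 - \<beta>\<^sup>2))"
proof -
  have nth [measurable]: "(\<lambda>v::complex^3. v $ i) \<in> borel_measurable borel" for i
    by (intro borel_measurable_continuous_onI continuous_intros)
  obtain p q r where pqr: "gauss_law as = gauss_law [p, q, r]" "\<And>k l. gram as k l = gram [p, q, r] k l"
    "q $ 1 = 0" "r $ 1 = 0" "r $ 2 = 0" by (rule gauss_law_triangular[of as]) blast
  have "complex_of_real ((cmod (p $ 1))\<^sup>2) = of_real h"
    using g(1) pqr by (simp add: complex_norm_square del: of_real_power)
  then have h: "h = (cmod (p $ 1))\<^sup>2" by (simp only: of_real_eq_iff)
  define K where "K = 1 + h"
  have K: "K > 0" using h by (simp add: K_def add_pos_nonneg)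
  define \<kappa> where "\<kappa> = sqrt (1 + (cmod (p $ 1))\<^sup>2)"
  have \<kappa>: "\<kappa>\<^sup>2 = K" "\<kappa> > 0" using K by (simp_all add: \<kappa>_def K_def h)
  define p' where "p' = of_real (1/\<kappa>) *s p"
  let ?J = "\<lambda>v::complex^3. ennreal \<bar>(cmod (v $ 2))\<^sup>2 - (cmod (v $ 3))\<^sup>2\<bar>"
  \<comment> \<open>After triangularisation only the first Gaussian enters coordinate 1, so the
    density factor tilts that variable alone and amounts to shrinking \<open>p\<close>.\<close>
  have tilt: "(\<integral>\<^sup>+v. ennreal (cgauss_density (v $ 1)) * ?J v \<partial>gauss_law as) =
      ennreal (1 / (pi * K)) * (\<integral>\<^sup>+v. ?J v \<partial>gauss_law [p', q, r])"
  proof -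
    have "(\<integral>\<^sup>+v. ennreal (cgauss_density (v $ 1)) * ?J v \<partial>gauss_law as) =
      (\<integral>\<^sup>+x. \<integral>\<^sup>+y. \<integral>\<^sup>+z. ennreal (cgauss_density (x * p $ 1)) * ?J (x *s p + (y *s q + z *s r)) \<partial>cgauss \<partial>cgauss \<partial>cgauss)"
      unfolding pqr(1) by (subst nn_integral_gauss_law_3) (measurable, simp add: pqr)
    also have "\<dots> = (\<integral>\<^sup>+x. ennreal (cgauss_density (x * p $ 1)) * (\<integral>\<^sup>+y. \<integral>\<^sup>+z. ?J (x *s p + (y *s q + z *s r)) \<partial>cgauss \<partial>cgauss) \<partial>cgauss)"
      by (simp add: nn_integral_cmult)
    also have "\<dots> = ennreal (1 / (pi * \<kappa>\<^sup>2)) *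
        (\<integral>\<^sup>+x. \<integral>\<^sup>+y. \<integral>\<^sup>+z. ?J ((of_real (1/\<kappa>) * x) *s p + (y *s q + z *s r)) \<partial>cgauss \<partial>cgauss \<partial>cgauss)"
      unfolding \<kappa>_def by (rule nn_integral_cgauss_tilt) measurable
    also have "(\<integral>\<^sup>+x. \<integral>\<^sup>+y. \<integral>\<^sup>+z. ?J ((of_real (1/\<kappa>) * x) *s p + (y *s q + z *s r)) \<partial>cgauss \<partial>cgauss \<partial>cgauss) =
        (\<integral>\<^sup>+v. ?J v \<partial>gauss_law [p', q, r])"
      by (subst nn_integral_gauss_law_3) (measurable, simp add: p'_def mult_ac)
    finally show ?thesis by (simp add: \<kappa>)
  qed
  \<comment> \<open>Shrinking \<open>p\<close> by 1/\<kappa> gives the usual formula for a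
    conditional covariance. The denominator is \<open>1 + h\<close> rather than \<open>h\<close>
    since the density is that of A_0, whose variance adds to that of coordinate 1.\<close>
  have gr: "gram [p', q, r] k l = gram as k l - gram as k 1 * cnj (gram as l 1) / of_real K" for k l
  proof -
    have k2: "of_real (1/\<kappa>) * cnj (of_real (1/\<kappa>)) = 1 / complex_of_real K"
      using \<kappa> by (simp add: power2_eq_square flip: of_real_mult)
    have "gram [p', q, r] k l = (of_real (1/\<kappa>) * cnj (of_real (1/\<kappa>))) * (p $ k * cnj (p $ l)) + (gram as k l - p $ k * cnj (p $ l))"
      by (simp add: pqr(2) p'_def algebra_simps)
    also have "\<dots> = gram as k l - p $ k * cnj (p $ l) * (1 - 1 / of_real K)"
      unfolding k2 by (simp add: algebra_simps)
    also have "1 - 1 / complex_of_real K = of_real h / of_real K"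
    proof -
      have "1 - 1 / K = h / K" using K by (simp add: K_def field_simps)
      from arg_cong[OF this, of complex_of_real] show ?thesis by simp
    qed
    also have "complex_of_real h = p $ 1 * cnj (p $ 1)"
      using h complex_norm_square[of "p $ 1"] by simp
    finally show ?thesis by (simp add: pqr(2-4) mult_ac)
  qed
  \<comment> \<open>The two remaining coordinates are moved to the front and padded with a zero, so
    that the three-dimensional triangular form applies once more.\<close>
  define L :: "complex^3 \<Rightarrow> complex^3" where "L a = vector [a $ 2, a $ 3, 0]" for a
  have L [simp]: "L a $ 1 = a $ 2" "L a $ 2 = a $ 3" "L a $ 3 = 0" for a by (simp_all add: L_def)
  have Lm: "L \<in> borel_measurable borel"
  proof (rule borel_measurable_continuous_onI)
    have "L = (\<lambda>a. \<chi> i. if i = 1 then a $ 2 else if i = 2 then a $ 3 else 0)"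
      by (rule ext) (simp add: vec_eq_iff forall_3)
    moreover have "continuous_on UNIV (\<lambda>a::complex^3. if i = 1 then a $ 2 else if i = (2::3) then a $ 3 else 0)" for i
      by (cases "i = 1"; cases "i = 2") (auto intro!: continuous_intros)
    ultimately show "continuous_on UNIV L" by (simp add: continuous_on_vec_lambda)
  qed
  obtain P Q R where PQR: "gauss_law (map L [p', q, r]) = gauss_law [P, Q, R]"
    "\<And>k l. gram (map L [p', q, r]) k l = gram [P, Q, R] k l" "Q $ 1 = 0" "R $ 1 = 0" "R $ 2 = 0"
    by (rule gauss_law_triangular[of "map L [p', q, r]"]) blast
  have GL: "gram (map L xs) 1 1 = gram xs 2 2" "gram (map L xs) 2 2 = gram xs 3 3" "gram (map L xs) 2 1 = gram xs 3 2" for xs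
    by (induction xs) auto
  have \<beta>K: "\<beta> = b2 / K" by (simp add: \<beta>_def K_def)
  have "complex_of_real ((cmod (P $ 1))\<^sup>2) = gram (map L [p', q, r]) 1 1"
    unfolding PQR(2) complex_norm_square using PQR by simp
  also have "\<dots> = of_real (c - \<beta>)"
    unfolding GL gr g \<beta>K by (simp add: b(1)[symmetric] flip: complex_norm_square)
  finally have s: "(cmod (P $ 1))\<^sup>2 = c - \<beta>" by (simp only: of_real_eq_iff)
  have "complex_of_real ((cmod (P $ 2))\<^sup>2 + (cmod (Q $ 2))\<^sup>2) = gram (map L [p', q, r]) 2 2"
    unfolding PQR(2) of_real_add complex_norm_square using PQR by simp
  also have "\<dots> = of_real (c - \<beta>)"
    unfolding GL gr g \<beta>K by (simp add: b(2)[symmetric] flip: complex_norm_square)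
  finally have tw: "(cmod (P $ 2))\<^sup>2 + (cmod (Q $ 2))\<^sup>2 = c - \<beta>" by (simp only: of_real_eq_iff)
  \<comment> \<open>The pair is uncorrelated before conditioning, so its covariance is just the
    subtracted term, of modulus \<beta>. Keeping it as a product avoids a division by
    \<open>P $ 1\<close>, which may vanish.\<close>
  have "P $ 2 * cnj (P $ 1) = gram (map L [p', q, r]) 2 1"
    unfolding PQR(2) using PQR by simp
  also have "\<dots> = - (gram as 3 1 * cnj (gram as 2 1) / of_real K)"
    unfolding GL gr g by simp
  finally have "(cmod (P $ 2))\<^sup>2 * (cmod (P $ 1))\<^sup>2 = (cmod (gram as 3 1 * cnj (gram as 2 1) / of_real K))\<^sup>2"
    by (metis complex_mod_cnj norm_minus_cancel norm_mult power_mult_distrib)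
  also have "\<dots> = \<beta>\<^sup>2"
    by (simp add: norm_mult norm_divide power_mult_distrib power_divide b \<beta>K) (simp add: power2_eq_square)
  finally have ts: "(cmod (P $ 2))\<^sup>2 * (cmod (P $ 1))\<^sup>2 = \<beta>\<^sup>2" .
  have "(\<integral>\<^sup>+v. ?J v \<partial>gauss_law [p', q, r]) = (\<integral>\<^sup>+v. (\<lambda>u. ennreal \<bar>(cmod (u $ 1))\<^sup>2 - (cmod (u $ 2))\<^sup>2\<bar>) (L v) \<partial>gauss_law [p', q, r])"
    by simp
  also have "\<dots> = (\<integral>\<^sup>+u. ennreal \<bar>(cmod (u $ 1))\<^sup>2 - (cmod (u $ 2))\<^sup>2\<bar> \<partial>gauss_law [P, Q, R])"
    unfolding PQR(1)[symmetric]
    by (rule nn_integral_gauss_law_map[OF _ Lm]) (measurable, simp_all add: vec_eq_iff forall_3)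
  also have "\<dots> = (\<integral>\<^sup>+x. \<integral>\<^sup>+y. ennreal \<bar>(cmod (x * P $ 1))\<^sup>2 - (cmod (x * P $ 2 + y * Q $ 2))\<^sup>2\<bar> \<partial>cgauss \<partial>cgauss)"
    by (subst nn_integral_gauss_law_3) (measurable, simp add: PQR cgauss.emeasure_space_1[simplified])
  also have "\<dots> = ennreal (cmod (P $ 1) * cmod (Q $ 2))"
    using s tw by (intro cgauss_expectation_abs_indefinite_form) simp
  also have "cmod (P $ 1) * cmod (Q $ 2) = sqrt ((c - \<beta>)\<^sup>2 - \<beta>\<^sup>2)"
  proof (rule real_sqrt_unique[symmetric])
    have "(cmod (P $ 1) * cmod (Q $ 2))\<^sup>2 = (cmod (P $ 1))\<^sup>2 * (c - \<beta> - (cmod (P $ 2))\<^sup>2)"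
      using tw by (simp add: power_mult_distrib)
    also have "\<dots> = (cmod (P $ 1))\<^sup>2 * (c - \<beta>) - (cmod (P $ 2))\<^sup>2 * (cmod (P $ 1))\<^sup>2"
      by (simp add: algebra_simps)
    also have "\<dots> = (c - \<beta>)\<^sup>2 - \<beta>\<^sup>2" unfolding ts unfolding s by (simp add: power2_eq_square)
    finally show "(cmod (P $ 1) * cmod (Q $ 2))\<^sup>2 = (c - \<beta>)\<^sup>2 - \<beta>\<^sup>2" .
  qed simp
  finally have J: "(\<integral>\<^sup>+v. ?J v \<partial>gauss_law [p', q, r]) = ennreal (sqrt ((c - \<beta>)\<^sup>2 - \<beta>\<^sup>2))" .
  show ?thesis
    unfolding tilt J K_def[symmetric] using K by (intro ennreal_mult'[symmetric]) simp
qed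

section \<open>The Kac--Rice formula\<close>

text \<open>Second moments at a point with \<open>r = |z|\<^sup>2\<close>: \<open>kac_a\<close> and \<open>kac_c\<close> are the variances of
  \<open>p(z)\<close> and \<open>p'(z)\<close>, and \<open>kac_b\<close> is their covariance up to a factor of modulus \<open>|z|\<close>.
  The truncated exponent \<open>k - 1\<close> is harmless because the term \<open>k = 0\<close> vanishes.\<close>
definition kac_a :: "nat \<Rightarrow> real \<Rightarrow> real" where
  "kac_a n r = (\<Sum>k\<le>n. r ^ k)"

definition kac_b :: "nat \<Rightarrow> real \<Rightarrow> real" where
  "kac_b n r = (\<Sum>k\<le>n. real k * r ^ (k - 1))"

definition kac_c :: "nat \<Rightarrow> real \<Rightarrow> real" where
  "kac_c n r = (\<Sum>k\<le>n. (real k)\<^sup>2 * r ^ (k - 1))"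

text \<open>Density of the expected number of zeros with respect to \<open>r = |z|\<^sup>2\<close>.\<close>
definition kac_density :: "nat \<Rightarrow> real \<Rightarrow> real" where
  "kac_density n r = sqrt ((kac_c n r)\<^sup>2 - kac_c n r * (r * (kac_b n r)\<^sup>2) / kac_a n r) / (2 * kac_a n r)"

lemma num_zeros_eq_emeasure: "num_zeros H T = emeasure (count_space UNIV) {z\<in>T. H z = 0}"
  by (simp add: num_zeros_def emeasure_count_space)

lemma borel_measurable_cnj [measurable (raw)]:
  "f \<in> borel_measurable M \<Longrightarrow> (\<lambda>x. cnj (f x)) \<in> borel_measurable M"
  by (rule measurable_compose[of f M borel cnj])
    (auto intro!: borel_measurable_continuous_onI continuous_intros)

text \<open>This is H without A_0: with A_0 = w, the zeros of H are the points where the negative of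
  this function takes the value w.\<close>

definition kac_shift :: "nat \<Rightarrow> (nat \<Rightarrow> complex) \<Rightarrow> (nat \<Rightarrow> complex) \<Rightarrow> complex \<Rightarrow> complex" where
  "kac_shift n a b z = (\<Sum>k\<in>{1..n}. a k * z ^ k) + cnj (\<Sum>k\<le>n. b k * z ^ k)"

text \<open>The index set is a parameter because p has lost its constant term while q keeps it. The
  truncated exponent at k = 0 is cancelled by the factor \<open>of_nat k\<close>.\<close>

definition deriv_coeffs :: "nat set \<Rightarrow> (nat \<Rightarrow> complex) \<Rightarrow> complex \<Rightarrow> complex" where
  "deriv_coeffs I a z = (\<Sum>k\<in>I. a k * (of_nat k * z ^ (k - 1)))"

lemma has_derivative_kac_shift:
  "((\<lambda>z. - kac_shift n a b z) has_derivative
    (\<lambda>h. - deriv_coeffs {1..n} a z * h + cnj (- deriv_coeffs {..n} b z * h))) (at z)"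
proof -
  have p: "((\<lambda>z. \<Sum>k\<in>I. a k * z ^ k) has_derivative (\<lambda>h. deriv_coeffs I a z * h)) (at z)" for I :: "nat set" and a
  proof -
    have "((\<lambda>z. \<Sum>k\<in>I. a k * z ^ k) has_field_derivative (\<Sum>k\<in>I. a k * (of_nat k * z ^ (k - 1)))) (at z)"
      by (intro DERIV_sum DERIV_cmult) (auto intro!: derivative_eq_intros)
    then show ?thesis by (simp add: has_field_derivative_def deriv_coeffs_def)
  qed
  have "((\<lambda>z. - ((\<Sum>k\<in>{1..n}. a k * z ^ k) + cnj (\<Sum>k\<le>n. b k * z ^ k))) has_derivative
    (\<lambda>h. - (deriv_coeffs {1..n} a z * h + cnj (deriv_coeffs {..n} b z * h)))) (at z)"
    by (intro has_derivative_minus has_derivative_add p bounded_linear.has_derivative[OF bounded_linear_cnj])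
  then show ?thesis by (simp add: kac_shift_def)
qed

lemma harm_poly_eq_shift: "harm_poly n (fun_upd a 0 w, b) z = w + kac_shift n a b z"
proof -
  have "{..n} = insert 0 {1..n}" by auto
  then have "(\<Sum>k\<le>n. (fun_upd a 0 w) k * z ^ k) = w + (\<Sum>k\<in>{1..n}. (fun_upd a 0 w) k * z ^ k)" by simp
  also have "(\<Sum>k\<in>{1..n}. (fun_upd a 0 w) k * z ^ k) = (\<Sum>k\<in>{1..n}. a k * z ^ k)"
    by (intro sum.cong) auto
  finally show ?thesis by (simp add: harm_poly_def kac_shift_def)
qed

lemma continuous_deriv_coeffs: "continuous_on UNIV (deriv_coeffs I a)"
  unfolding deriv_coeffs_def[abs_def] by (intro continuous_intros)

text \<open>With the other coefficients frozen, averaging over A_0 is the area formula for the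
  negative of \<open>kac_shift\<close>, with the Gaussian density as weight. It holds for all
  \<open>a\<close> and \<open>b\<close>, so no genericity of the coefficients has to be
  discussed.\<close>

lemma kac_rice_fixed:
  assumes T: "closed T"
  shows "(\<integral>\<^sup>+w. num_zeros (harm_poly n (fun_upd a 0 w, b)) T \<partial>cgauss) =
    (\<integral>\<^sup>+z. ennreal (cgauss_density (kac_shift n a b z) *
       \<bar>(cmod (deriv_coeffs {1..n} a z))\<^sup>2 - (cmod (deriv_coeffs {..n} b z))\<^sup>2\<bar>) * indicator T z \<partial>lborel)"
proof -
  let ?G = "\<lambda>z. - kac_shift n a b z"
  have contG: "continuous_on UNIV ?G"
    by (intro continuous_at_imp_continuous_on ballI has_derivative_continuous[OF has_derivative_kac_shift])
  have c: "num_zeros (harm_poly n (fun_upd a 0 w, b)) T = emeasure (count_space UNIV) {z\<in>T. ?G z = w}" for w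
    unfolding num_zeros_eq_emeasure harm_poly_eq_shift
    by (rule arg_cong[where f="emeasure (count_space UNIV)"]) (auto simp: neg_eq_iff_add_eq_0 add.commute)
  have m: "(\<lambda>w. emeasure (count_space UNIV) {z\<in>T. ?G z = w}) \<in> borel_measurable borel"
  proof -
    have "(\<lambda>w. emeasure (count_space UNIV) {z\<in>T. ?G z - w = 0}) \<in> borel_measurable borel"
    proof (rule measurable_count_zeros[OF _ _ T])
      show "continuous_on UNIV (\<lambda>z. ?G z - w)" for w
        by (rule continuous_on_diff[OF contG continuous_on_const])
    qed measurable
    then show ?thesis by simp
  qed
  have "(\<integral>\<^sup>+w. num_zeros (harm_poly n (fun_upd a 0 w, b)) T \<partial>cgauss) =
      (\<integral>\<^sup>+w. ennreal (cgauss_density w) * emeasure (count_space UNIV) {z\<in>T. ?G z = w} \<partial>lborel)"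
    unfolding c by (rule nn_integral_cgauss[OF m])
  also have "\<dots> = (\<integral>\<^sup>+z. ennreal (cgauss_density (?G z) *
       \<bar>(cmod (- deriv_coeffs {1..n} a z))\<^sup>2 - (cmod (- deriv_coeffs {..n} b z))\<^sup>2\<bar>) * indicator T z \<partial>lborel)"
    by (intro area_formula_complex has_derivative_kac_shift m integrable_cgauss_density continuous_on_minus
        continuous_deriv_coeffs cgauss_density_nonneg borel_closed T)
  finally show ?thesis by (simp add: cgauss_density_def)
qed

text \<open>The integrand depends on H - A_0, p' and the conjugate of q' at \<open>z\<close>, and
  each coefficient contributes one vector of three entries: \<open>va\<close> for the analytic half,
  \<open>vb\<close> for the other. The halves share only coordinate 1, so p' and q' are
  uncorrelated. The conditional formula is then used with variance 2a - 1, common variance c and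
  squared covariances r b^2.\<close>

lemma kac_rice_pointwise:
  "(\<integral>\<^sup>+b. \<integral>\<^sup>+a. ennreal (cgauss_density (kac_shift n a b z) *
       \<bar>(cmod (deriv_coeffs {1..n} a z))\<^sup>2 - (cmod (deriv_coeffs {..n} b z))\<^sup>2\<bar>)
       \<partial>PiM {1..n} (\<lambda>_. cgauss) \<partial>PiM {..n} (\<lambda>_. cgauss)) = ennreal (kac_density n ((cmod z)\<^sup>2) / pi)"
proof -
  have nth [measurable]: "(\<lambda>v::complex^3. v $ i) \<in> borel_measurable borel" for i
    by (intro borel_measurable_continuous_onI continuous_intros)
  define r where "r = (cmod z)\<^sup>2"
  have r: "r \<ge> 0" by (simp add: r_def)
  have zr: "z * cnj z = of_real r" using complex_norm_square[of z] by (simp add: r_def)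
  define va :: "nat \<Rightarrow> complex^3" where "va k = vector [z ^ k, of_nat k * z ^ (k - 1), 0]" for k
  define vb :: "nat \<Rightarrow> complex^3" where "vb k = vector [cnj z ^ k, 0, of_nat k * cnj z ^ (k - 1)]" for k
  have v [simp]: "va k $ 1 = z ^ k" "va k $ 2 = of_nat k * z ^ (k - 1)" "va k $ 3 = 0"
    "vb k $ 1 = cnj z ^ k" "vb k $ 2 = 0" "vb k $ 3 = of_nat k * cnj z ^ (k - 1)" for k
    by (simp_all add: va_def vb_def)
  let ?f = "\<lambda>v::complex^3. ennreal (cgauss_density (v $ 1)) * ennreal \<bar>(cmod (v $ 2))\<^sup>2 - (cmod (v $ 3))\<^sup>2\<bar>"
  let ?as = "map va [1..<Suc n]" and ?bs = "map vb [0..<Suc n]"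
  have f: "?f \<in> borel_measurable borel" by measurable
  have sums: "(\<Sum>k\<in>I. h k *s g k) $ i = (\<Sum>k\<in>I. h k * g k $ i)" for I :: "nat set" and h and g :: "nat \<Rightarrow> complex^3" and i
    by simp
  have "ennreal (cgauss_density (kac_shift n a b z) *
       \<bar>(cmod (deriv_coeffs {1..n} a z))\<^sup>2 - (cmod (deriv_coeffs {..n} b z))\<^sup>2\<bar>) =
     ?f ((\<Sum>k\<in>{..n}. cnj (b k) *s vb k) + (\<Sum>k\<in>{1..n}. a k *s va k))" for a b
  proof -
    have "cnj (deriv_coeffs {..n} b z) = (\<Sum>k\<in>{..n}. cnj (b k) * (of_nat k * cnj z ^ (k - 1)))"
      by (simp add: deriv_coeffs_def)
    then have "cmod (deriv_coeffs {..n} b z) = cmod (\<Sum>k\<in>{..n}. cnj (b k) * (of_nat k * cnj z ^ (k - 1)))"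
      by (metis complex_mod_cnj)
    then show ?thesis
      unfolding vector_add_component sums v kac_shift_def
      by (simp add: deriv_coeffs_def ennreal_mult add.commute)
  qed
  then have "(\<integral>\<^sup>+b. \<integral>\<^sup>+a. ennreal (cgauss_density (kac_shift n a b z) *
       \<bar>(cmod (deriv_coeffs {1..n} a z))\<^sup>2 - (cmod (deriv_coeffs {..n} b z))\<^sup>2\<bar>)
       \<partial>PiM {1..n} (\<lambda>_. cgauss) \<partial>PiM {..n} (\<lambda>_. cgauss)) =
     (\<integral>\<^sup>+b. \<integral>\<^sup>+a. ?f ((\<Sum>k\<in>{..n}. cnj (b k) *s vb k) + (\<Sum>k\<in>{1..n}. a k *s va k))
       \<partial>PiM {1..n} (\<lambda>_. cgauss) \<partial>PiM {..n} (\<lambda>_. cgauss))" by simp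
  also have "\<dots> = (\<integral>\<^sup>+b. \<integral>\<^sup>+v. ?f ((\<Sum>k\<in>{..n}. cnj (b k) *s vb k) + v) \<partial>gauss_law ?as \<partial>PiM {..n} (\<lambda>_. cgauss))"
  proof (rule nn_integral_cong)
    fix b
    have "(\<lambda>v. ?f ((\<Sum>k\<in>{..n}. cnj (b k) *s vb k) + v)) \<in> borel_measurable borel" by measurable
    from nn_integral_PiM_gauss_law[OF this distinct_upt[of 1 "Suc n"] measurable_ident_sets[OF refl] refl, of va]
    show "(\<integral>\<^sup>+a. ?f ((\<Sum>k\<in>{..n}. cnj (b k) *s vb k) + (\<Sum>k\<in>{1..n}. a k *s va k)) \<partial>PiM {1..n} (\<lambda>_. cgauss)) =
       (\<integral>\<^sup>+v. ?f ((\<Sum>k\<in>{..n}. cnj (b k) *s vb k) + v) \<partial>gauss_law ?as)"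
      by (simp only: set_upt atLeastLessThanSuc_atLeastAtMost)
  qed
  also have "\<dots> = (\<integral>\<^sup>+u. \<integral>\<^sup>+v. ?f (u + v) \<partial>gauss_law ?as \<partial>gauss_law ?bs)"
  proof -
    interpret as: prob_space "gauss_law ?as" by (rule prob_space_gauss_law)
    have "(\<lambda>u. \<integral>\<^sup>+v. ?f (u + v) \<partial>gauss_law ?as) \<in> borel_measurable borel" by measurable
    from nn_integral_PiM_gauss_law[OF this distinct_upt[of 0 "Suc n"] borel_measurable_cnj[OF measurable_ident_sets[OF refl]]
        nn_integral_cgauss_cnj, of vb]
    show ?thesis by (simp only: set_upt atLeast0LessThan lessThan_Suc_atMost)
  qed
  also have "\<dots> = (\<integral>\<^sup>+v. ?f v \<partial>gauss_law (?bs @ ?as))"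
    by (rule nn_integral_gauss_law_append[OF f, symmetric])
  also have "\<dots> = ennreal (kac_density n r / pi)"
  proof -
    define S0 where "S0 = (\<Sum>k\<le>n. r ^ k)"
    define B where "B = (\<Sum>k\<le>n. real k * r ^ (k - 1))"
    define C where "C = (\<Sum>k\<le>n. (real k)\<^sup>2 * r ^ (k - 1))"
    have gsum: "gram (?bs @ ?as) i j = (\<Sum>k\<le>n. vb k $ i * cnj (vb k $ j)) + (\<Sum>k\<in>{1..n}. va k $ i * cnj (va k $ j))" for i j
    proof -
      have "gram (?bs @ ?as) i j = (\<Sum>k\<leftarrow>[0..<Suc n]. vb k $ i * cnj (vb k $ j)) + (\<Sum>k\<leftarrow>[1..<Suc n]. va k $ i * cnj (va k $ j))"
        by (simp only: gram_def map_append sum_list_append map_map o_def)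
      also have "\<dots> = (\<Sum>k\<le>n. vb k $ i * cnj (vb k $ j)) + (\<Sum>k\<in>{1..n}. va k $ i * cnj (va k $ j))"
        by (simp only: sum_set_upt_conv_sum_list_nat[symmetric] set_upt atLeastLessThanSuc_atLeastAtMost atLeast0AtMost)
      finally show ?thesis .
    qed
    \<comment> \<open>The sum over the coefficients of p starts at 1. The missing term is 1 for the
      variance in coordinate 1 and 0 in every other entry that is needed.\<close>
    have s1: "(\<Sum>k\<in>{1..n}. g k) = (\<Sum>k\<le>n. g k) - g 0" for g :: "nat \<Rightarrow> complex"
    proof -
      have "{..n} = insert 0 {1..n}" by auto
      then show ?thesis by simp
    qed
    have pw: "z ^ k * cnj z ^ k = of_real (r ^ k)" "cnj z ^ k * z ^ k = of_real (r ^ k)" for k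
      using zr by (simp_all flip: power_mult_distrib add: mult.commute)
    have pw2: "of_nat k * z ^ (k - 1) * (of_nat k * cnj z ^ (k - 1)) = of_real ((real k)\<^sup>2 * r ^ (k - 1))"
      "of_nat k * cnj z ^ (k - 1) * (of_nat k * z ^ (k - 1)) = of_real ((real k)\<^sup>2 * r ^ (k - 1))" for k
      using pw[of "k - 1"] by (simp_all add: power2_eq_square mult_ac)
    have pw3: "of_nat k * z ^ (k - 1) * cnj z ^ k = cnj z * of_real (real k * r ^ (k - 1))"
      "of_nat k * cnj z ^ (k - 1) * z ^ k = z * of_real (real k * r ^ (k - 1))" for k
      using pw[of "k - 1"] by (cases k; simp add: mult_ac)+
    \<comment> \<open>One full sum comes from q and one without k = 0 from p. The 1 that is missing
      here is restored by A_0, so that \<open>1 + h\<close> becomes twice \<open>S0\<close>.\<close>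
    have g11: "gram (?bs @ ?as) 1 1 = of_real (2 * S0 - 1)"
      unfolding gsum s1 by (simp add: pw S0_def)
    have g22: "gram (?bs @ ?as) 2 2 = of_real C" and g33: "gram (?bs @ ?as) 3 3 = of_real C"
      unfolding gsum s1 by (simp_all add: pw2[unfolded One_nat_def] C_def)
    have g32: "gram (?bs @ ?as) 3 2 = 0" unfolding gsum by simp
    have g21: "gram (?bs @ ?as) 2 1 = cnj z * of_real B" and g31: "gram (?bs @ ?as) 3 1 = z * of_real B"
      unfolding gsum s1 by (simp_all add: pw3[unfolded One_nat_def] B_def sum_distrib_left)
    have b2: "(cmod (gram (?bs @ ?as) 2 1))\<^sup>2 = r * B\<^sup>2" "(cmod (gram (?bs @ ?as) 3 1))\<^sup>2 = r * B\<^sup>2"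
      unfolding g21 g31 by (simp_all add: norm_mult power_mult_distrib r_def)
    have "S0 \<ge> 1" unfolding S0_def using r sum_mono2[of "{..n}" "{0}" "\<lambda>k. r ^ k"] by simp
    then have "(C - r * B\<^sup>2 / (1 + (2 * S0 - 1)))\<^sup>2 - (r * B\<^sup>2 / (1 + (2 * S0 - 1)))\<^sup>2 = C\<^sup>2 - C * (r * B\<^sup>2) / S0"
      by (simp add: power2_eq_square field_simps)
    then show ?thesis
      unfolding gauss_law_conditional_abs_Jacobian[OF g11 g22 g33 g32 b2] kac_density_def kac_a_def kac_b_def kac_c_def
        S0_def[symmetric] B_def[symmetric] C_def[symmetric] by (simp add: mult_ac)
  qed
  finally show ?thesis by (simp add: r_def)
qed

text \<open>All integrands are nonnegative, so Tonelli's theorem permits integrating A_0 first and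
  moving the integral over \<open>z\<close> outside. Closedness of \<open>T\<close> is what makes
  the number of zeros measurable.\<close>

theorem kac_rice:
  assumes T: "closed T"
  shows "expected_zeros n T = (\<integral>\<^sup>+z. ennreal (kac_density n ((cmod z)\<^sup>2) / pi) * indicator T z \<partial>lborel)"
proof -
  let ?A = "PiM {..n} (\<lambda>_. cgauss)" and ?A' = "PiM {1..n} (\<lambda>_. cgauss)"
  interpret A: prob_space ?A by (rule prob_space_PiM) (rule cgauss.prob_space_axioms)
  interpret A': prob_space ?A' by (rule prob_space_PiM) (rule cgauss.prob_space_axioms)
  interpret AA: pair_sigma_finite ?A ?A ..
  interpret LA: pair_sigma_finite lborel ?A ..
  interpret LA': pair_sigma_finite lborel ?A' ..
  have [measurable]: "T \<in> sets borel" using T by (rule borel_closed)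
  have N [measurable]: "(\<lambda>\<omega>. num_zeros (harm_poly n \<omega>) T) \<in> borel_measurable (?A \<Otimes>\<^sub>M ?A)"
    unfolding num_zeros_eq_emeasure
  proof (rule measurable_count_zeros[OF _ _ T])
    show "continuous_on UNIV (harm_poly n \<omega>)" for \<omega>
      unfolding harm_poly_def[abs_def] by (intro continuous_intros)
    show "(\<lambda>\<omega>. harm_poly n \<omega> z) \<in> borel_measurable (?A \<Otimes>\<^sub>M ?A)" for z
      unfolding harm_poly_def by measurable
  qed
  have ins: "insert 0 {1..n} = {..n}" by auto
  let ?F = "\<lambda>z b a. ennreal (cgauss_density (kac_shift n a b z) *
       \<bar>(cmod (deriv_coeffs {1..n} a z))\<^sup>2 - (cmod (deriv_coeffs {..n} b z))\<^sup>2\<bar>)"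
  have m1 [measurable]: "(\<lambda>(z, b, a). ?F z b a) \<in> borel_measurable (lborel \<Otimes>\<^sub>M ?A \<Otimes>\<^sub>M ?A')"
    unfolding kac_shift_def deriv_coeffs_def by measurable
  have "expected_zeros n T = (\<integral>\<^sup>+b. \<integral>\<^sup>+a. num_zeros (harm_poly n (a, b)) T \<partial>?A \<partial>?A)"
    unfolding expected_zeros_def kac_coeffs_def by (subst AA.nn_integral_snd[symmetric]) auto
  also have "\<dots> = (\<integral>\<^sup>+b. \<integral>\<^sup>+a. \<integral>\<^sup>+w. num_zeros (harm_poly n (fun_upd a 0 w, b)) T \<partial>cgauss \<partial>?A' \<partial>?A)"
  proof (rule nn_integral_cong)
    fix b assume "b \<in> space ?A"
    then have "(\<lambda>a. num_zeros (harm_poly n (a, b)) T) \<in> borel_measurable (PiM (insert 0 {1..n}) (\<lambda>_. cgauss))"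
      unfolding ins by measurable
    from cgauss_product.product_nn_integral_insert[OF _ _ this]
    show "(\<integral>\<^sup>+a. num_zeros (harm_poly n (a, b)) T \<partial>?A) =
        (\<integral>\<^sup>+a. \<integral>\<^sup>+w. num_zeros (harm_poly n (fun_upd a 0 w, b)) T \<partial>cgauss \<partial>?A')"
      unfolding ins by simp
  qed
  also have "\<dots> = (\<integral>\<^sup>+b. \<integral>\<^sup>+a. \<integral>\<^sup>+z. ?F z b a * indicator T z \<partial>lborel \<partial>?A' \<partial>?A)"
    by (simp only: kac_rice_fixed[OF T])
  also have "\<dots> = (\<integral>\<^sup>+b. \<integral>\<^sup>+z. \<integral>\<^sup>+a. ?F z b a * indicator T z \<partial>?A' \<partial>lborel \<partial>?A)"
  proof (rule nn_integral_cong)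
    fix b assume b: "b \<in> space ?A"
    have "(\<lambda>(z, a). ?F z b a * indicator T z) \<in> borel_measurable (lborel \<Otimes>\<^sub>M ?A')"
      using b unfolding kac_shift_def deriv_coeffs_def by measurable
    from LA'.Fubini'[OF this, symmetric]
    show "(\<integral>\<^sup>+a. \<integral>\<^sup>+z. ?F z b a * indicator T z \<partial>lborel \<partial>?A') = (\<integral>\<^sup>+z. \<integral>\<^sup>+a. ?F z b a * indicator T z \<partial>?A' \<partial>lborel)" by simp
  qed
  also have "\<dots> = (\<integral>\<^sup>+z. \<integral>\<^sup>+b. \<integral>\<^sup>+a. ?F z b a * indicator T z \<partial>?A' \<partial>?A \<partial>lborel)"
  proof -
    have "(\<lambda>(z, b). \<integral>\<^sup>+a. ?F z b a * indicator T z \<partial>?A') \<in> borel_measurable (lborel \<Otimes>\<^sub>M ?A)"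
      unfolding kac_shift_def deriv_coeffs_def by measurable
    from LA.Fubini'[OF this, symmetric] show ?thesis by simp
  qed
  also have "\<dots> = (\<integral>\<^sup>+z. (\<integral>\<^sup>+b. \<integral>\<^sup>+a. ?F z b a \<partial>?A' \<partial>?A) * indicator T z \<partial>lborel)"
  proof (rule nn_integral_cong)
    fix z :: complex
    show "(\<integral>\<^sup>+b. \<integral>\<^sup>+a. ?F z b a * indicator T z \<partial>?A' \<partial>?A) = (\<integral>\<^sup>+b. \<integral>\<^sup>+a. ?F z b a \<partial>?A' \<partial>?A) * indicator T z"
      by (cases "z \<in> T") auto
  qed
  finally show ?thesis by (simp only: kac_rice_pointwise)
qed

text \<open>The density depends on |z|^2 only, and the constant pi of the radial substitution
  cancels the 1/pi of the Kac-Rice density.\<close>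

corollary expected_zeros_radial:
  assumes R: "closed R"
  shows "expected_zeros n {z. (cmod z)\<^sup>2 \<in> R} = (\<integral>\<^sup>+r. ennreal (kac_density n r) * indicator (R \<inter> {0..}) r \<partial>lborel)"
proof -
  have [measurable]: "R \<in> sets borel" using R by (rule borel_closed)
  have [measurable]: "kac_density n \<in> borel_measurable borel"
    unfolding kac_density_def[abs_def] kac_a_def kac_b_def kac_c_def by measurable
  have "closed {z. (cmod z)\<^sup>2 \<in> R}"
    using closed_vimage[OF R, of "\<lambda>z. (cmod z)\<^sup>2"] by (simp add: vimage_def continuous_intros)
  then have "expected_zeros n {z. (cmod z)\<^sup>2 \<in> R} =
      (\<integral>\<^sup>+z. (\<lambda>r. ennreal (kac_density n r / pi) * indicator R r) ((cmod z)\<^sup>2) \<partial>lborel)"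
    by (subst kac_rice) (auto intro!: nn_integral_cong simp: indicator_def)
  also have "\<dots> = (\<integral>\<^sup>+r. ennreal pi * ((ennreal (kac_density n r / pi) * indicator R r) * indicator {0..} r) \<partial>lborel)"
    by (rule nn_integral_cmod_power2) measurable
  also have "\<dots> = (\<integral>\<^sup>+r. ennreal (kac_density n r) * indicator (R \<inter> {0..}) r \<partial>lborel)"
  proof (rule nn_integral_cong)
    fix r
    have "ennreal pi * ennreal (kac_density n r / pi) = ennreal (kac_density n r)"
      by (subst ennreal_mult'[symmetric]) auto
    then show "ennreal pi * ((ennreal (kac_density n r / pi) * indicator R r) * indicator {0..} r) =
      ennreal (kac_density n r) * indicator (R \<inter> {0..}) r"
      by (simp add: indicator_def)
  qed
  finally show ?thesis .
qed

section \<open>Bounds on the density and asymptotics\<close>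

text \<open>With b = a' and c = (r a')', the geometric sum formula and its derivatives give this
  identity and the two that follow: differentiate once, then multiply by r and differentiate
  again.\<close>

lemma kac_a_rec: "(r - 1) * kac_a n r = r ^ Suc n - 1"
  by (induction n) (simp_all add: kac_a_def algebra_simps)

lemma kac_b_rec: "(r - 1) * kac_b n r = (real n + 1) * r ^ n - kac_a n r"
  by (induction n) (simp_all add: kac_a_def kac_b_def algebra_simps)

lemma kac_c_rec: "(r - 1) * kac_c n r = (real n + 1)\<^sup>2 * r ^ n - 2 * r * kac_b n r - kac_a n r"
  by (induction n) (simp_all add: kac_a_def kac_b_def kac_c_def algebra_simps power2_eq_square)

text \<open>The quotient (a c - r b^2) / a^2 is the derivative of r a' / a, and the closed form of
  the geometric sum makes it 1/(r - 1)^2 minus a positive term for positive r different from 1.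
  Clearing denominators leaves a polynomial identity that also holds at r = 1.\<close>

lemma kac_discriminant:
  "(r - 1)\<^sup>2 * (kac_a n r * kac_c n r - r * (kac_b n r)\<^sup>2) = (kac_a n r)\<^sup>2 - (real n + 1)\<^sup>2 * r ^ n"
proof -
  have "(r - 1)\<^sup>2 * (a * c - r * b\<^sup>2) = a\<^sup>2 - N\<^sup>2 * Q"
    if "(r - 1) * a = r * Q - 1" "(r - 1) * b = N * Q - a" "(r - 1) * c = N\<^sup>2 * Q - 2 * r * b - a"
    for a b c N Q :: real
    using that by algebra
  from this[OF _ kac_b_rec kac_c_rec] show ?thesis using kac_a_rec[of r n] by simp
qed

lemma kac_a_ge: "0 \<le> r \<Longrightarrow> 1 \<le> kac_a n r" "0 \<le> r \<Longrightarrow> r ^ n \<le> kac_a n r"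
  using sum_mono2[of "{..n}" "{0}" "\<lambda>k. r ^ k"] sum_mono2[of "{..n}" "{n}" "\<lambda>k. r ^ k"]
  by (simp_all add: kac_a_def)

lemma kac_c_nonneg: "0 \<le> r \<Longrightarrow> 0 \<le> kac_c n r"
  by (simp add: kac_c_def sum_nonneg)

section \<open>Bounds on the second moments and on the density\<close>

lemma kac_b_le: "0 \<le> r \<Longrightarrow> r * kac_b n r \<le> real n * kac_a n r"
  unfolding kac_a_def kac_b_def sum_distrib_left
proof (rule sum_mono)
  fix k assume "0 \<le> r" "k \<in> {..n}"
  then have "real k * r ^ k \<le> real n * r ^ k" by (intro mult_right_mono) auto
  then show "r * (real k * r ^ (k - 1)) \<le> real n * r ^ k"
    by (cases k) (auto simp: mult_ac)
qed

lemma kac_c_le': "0 \<le> r \<Longrightarrow> r * kac_c n r \<le> (real n)\<^sup>2 * kac_a n r"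
  unfolding kac_a_def kac_c_def sum_distrib_left
proof (rule sum_mono)
  fix k assume *: "0 \<le> r" "k \<in> {..n}"
  then have "(real k)\<^sup>2 * r ^ k \<le> (real n)\<^sup>2 * r ^ k" by (intro mult_right_mono power_mono) auto
  then show "r * ((real k)\<^sup>2 * r ^ (k - 1)) \<le> (real n)\<^sup>2 * r ^ k"
    by (cases k) (auto simp: mult_ac)
qed

text \<open>Shifting the index compares k^2 r^(k - 1) with the preceding power in a. This bound
  serves near r = 0, where the one with the extra factor r is too weak; the latter is better for r >
  1.\<close>

lemma kac_c_le:
  assumes "0 \<le> r"
  shows "kac_c n r \<le> (real n)\<^sup>2 * kac_a n r"
proof (cases n)
  case (Suc m)
  have "kac_c n r = (\<Sum>k\<le>m. (real (Suc k))\<^sup>2 * r ^ k)"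
    unfolding kac_c_def Suc by (subst sum.atMost_Suc_shift) simp
  also have "\<dots> \<le> (\<Sum>k\<le>m. (real n)\<^sup>2 * r ^ k)"
    using assms by (intro sum_mono mult_right_mono power_mono) (auto simp: Suc)
  also have "\<dots> = (real n)\<^sup>2 * kac_a m r" by (simp add: kac_a_def sum_distrib_left)
  also have "\<dots> \<le> (real n)\<^sup>2 * kac_a n r"
    using assms by (intro mult_left_mono) (auto simp: kac_a_def Suc)
  finally show ?thesis .
qed (simp add: kac_c_def kac_a_def)

text \<open>The square of twice the density is the product of c / a and the derivative of r a' / a.
  The upper and lower bounds treat these two factors separately.\<close>

lemma kac_density_eq:
  fixes n :: nat and r :: real
  assumes "0 \<le> r"
  defines "a \<equiv> kac_a n r" and "b \<equiv> kac_b n r" and "c \<equiv> kac_c n r"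
  shows "kac_density n r = sqrt ((c / a) * ((a * c - r * b\<^sup>2) / a\<^sup>2)) / 2"
proof -
  have a: "a > 0" using kac_a_ge(1)[OF assms(1), of n] by (simp add: a_def)
  have "(c / a) * ((a * c - r * b\<^sup>2) / a\<^sup>2) = (c\<^sup>2 - c * (r * b\<^sup>2) / a) / a\<^sup>2"
    using a by (simp add: field_simps power2_eq_square)
  then have "sqrt ((c / a) * ((a * c - r * b\<^sup>2) / a\<^sup>2)) = sqrt (c\<^sup>2 - c * (r * b\<^sup>2) / a) / a"
    using a by (simp add: real_sqrt_divide)
  then show ?thesis
    by (simp add: kac_density_def a_def b_def c_def)
qed

text \<open>Here \<open>x\<close> bounds the square root of c / a. The other factor is at most 1/(r
  - 1)^2 by \<open>kac_discriminant\<close>, whose subtracted term is nonnegative, and at most n^2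
  after dropping r b^2; the second bound bridges the singularity at r = 1.\<close>

lemma kac_density_le:
  assumes r: "0 \<le> r" and c: "kac_c n r / kac_a n r \<le> x\<^sup>2" and x: "0 \<le> x"
  shows "r \<noteq> 1 \<Longrightarrow> kac_density n r \<le> x / \<bar>r - 1\<bar> / 2" "kac_density n r \<le> x * real n / 2"
proof -
  let ?a = "kac_a n r" and ?b = "kac_b n r" and ?c = "kac_c n r"
  have a: "?a > 0" using kac_a_ge(1)[OF r, of n] by simp
  have c0: "0 \<le> ?c / ?a" using a kac_c_nonneg[OF r, of n] by simp
  have *: "kac_density n r \<le> x * y / 2" if "(?a * ?c - r * ?b\<^sup>2) / ?a\<^sup>2 \<le> y\<^sup>2" "0 \<le> y" for y
  proof -
    have "(?c / ?a) * ((?a * ?c - r * ?b\<^sup>2) / ?a\<^sup>2) \<le> (?c / ?a) * y\<^sup>2" using that c0 by (intro mult_left_mono) auto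
    also have "\<dots> \<le> x\<^sup>2 * y\<^sup>2" using c by (intro mult_right_mono) auto
    finally have "sqrt ((?c / ?a) * ((?a * ?c - r * ?b\<^sup>2) / ?a\<^sup>2)) \<le> sqrt ((x * y)\<^sup>2)"
      by (simp add: power_mult_distrib)
    then show ?thesis using x that(2) by (simp add: kac_density_eq[OF r])
  qed
  show "kac_density n r \<le> x / \<bar>r - 1\<bar> / 2" if "r \<noteq> 1"
  proof -
    have "(r - 1)\<^sup>2 * (?a * ?c - r * ?b\<^sup>2) \<le> ?a\<^sup>2"
      unfolding kac_discriminant using r by simp
    then have "(?a * ?c - r * ?b\<^sup>2) / ?a\<^sup>2 \<le> (1 / \<bar>r - 1\<bar>)\<^sup>2"
      using that a by (simp add: power_divide field_simps)
    from *[OF this] show ?thesis by simp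
  qed
  have "?a * ?c - r * ?b\<^sup>2 \<le> ?a * ?c" using r by simp
  also have "\<dots> \<le> ?a * ((real n)\<^sup>2 * ?a)" using kac_c_le[OF r, of n] a by (intro mult_left_mono) auto
  finally have "(?a * ?c - r * ?b\<^sup>2) / ?a\<^sup>2 \<le> (real n)\<^sup>2"
    using a by (simp add: field_simps power2_eq_square)
  from *[OF this] show "kac_density n r \<le> x * real n / 2" by simp
qed

lemma kac_density_le_square: "0 \<le> r \<Longrightarrow> kac_density n r \<le> (real n)\<^sup>2 / 2"
  using kac_density_le(2)[of r n "real n"] kac_c_le[of r n] kac_a_ge(1)[of r n]
  by (simp add: divide_le_eq power2_eq_square)

text \<open>For r < 1 the powers r^n enter the recursions with a favourable sign and are dropped,
  which gives c / a \<le> (1 + r) / (1 - r)^2. Rounding 1 + r up to 4 makes the square root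
  exact.\<close>

lemma kac_density_le_inside:
  assumes "0 \<le> r" "r < 1"
  shows "kac_density n r \<le> 1 / (1 - r)\<^sup>2"
proof -
  let ?a = "kac_a n r" and ?b = "kac_b n r" and ?c = "kac_c n r"
  have a: "?a > 0" using kac_a_ge(1)[OF assms(1), of n] by simp
  have "(1 - r) * ?b = ?a - (real n + 1) * r ^ n" using kac_b_rec[of r n] by (simp add: algebra_simps)
  then have b: "(1 - r) * ?b \<le> ?a" using assms(1) by simp
  have "(1 - r) * ?c = 2 * r * ?b + ?a - (real n + 1)\<^sup>2 * r ^ n" using kac_c_rec[of r n] by (simp add: algebra_simps)
  then have "(1 - r) * ?c \<le> 2 * r * ?b + ?a" using assms(1) by simp
  then have "(1 - r) * ((1 - r) * ?c) \<le> (1 - r) * (2 * r * ?b + ?a)"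
    using assms by (intro mult_left_mono) auto
  also have "\<dots> = 2 * r * ((1 - r) * ?b) + (1 - r) * ?a" by (simp add: algebra_simps)
  also have "\<dots> \<le> 2 * r * ?a + (1 - r) * ?a" using b assms(1) by (intro add_right_mono mult_left_mono) auto
  also have "\<dots> = (1 + r) * ?a" by (simp add: algebra_simps)
  also have "\<dots> \<le> 4 * ?a" using a assms by (intro mult_right_mono) auto
  finally have "(1 - r)\<^sup>2 * ?c \<le> 4 * ?a" by (simp add: power2_eq_square mult_ac)
  then have "?c / ?a \<le> (2 / (1 - r))\<^sup>2"
    using a assms by (simp add: power_divide field_simps)
  from kac_density_le(1)[OF assms(1) this] show ?thesis
    using assms by (simp add: power2_eq_square)
qed

text \<open>The factor \<open>sqrt r\<close>, gained from r c \<le> n^2 a, makes the bound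
  integrable at infinity; without it the integral would diverge logarithmically.\<close>

lemma kac_density_le_outside:
  assumes "1 < r"
  shows "kac_density n r \<le> real n / (sqrt r * (r - 1)) / 2"
proof -
  have a: "kac_a n r > 0" using kac_a_ge(1)[of r n] assms by simp
  have "kac_c n r / kac_a n r \<le> (real n / sqrt r)\<^sup>2"
    using kac_c_le'[of r n] a assms by (simp add: power_divide field_simps)
  from kac_density_le(1)[OF _ this] show ?thesis using assms by simp
qed

text \<open>The parameters make the bound uniform on an annulus: \<open>q\<close> bounds r from
  above, \<open>x\<close> bounds r - 1 from below, and \<open>E\<close> bounds r^n from below. The
  recursion for c with r b \<le> n a and r^n / a \<ge> (r - 1) / r gives c / a \<ge> n^2 / q - 3 n /
  x, where 2 n + 1 \<le> 3 n. The correction in the discriminant is at most (n + 1)^2 / E, since a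
  is at least r^n.\<close>

lemma kac_density_ge_outside:
  assumes r: "1 < r" "r \<le> q" and x: "0 < x" "x \<le> r - 1" and n: "n \<ge> 1"
    and E: "E \<le> r ^ n" "0 < E" and pos: "0 \<le> 1 / q - 3 / (real n * x)" "0 \<le> 1 - (real n + 1)\<^sup>2 / E"
  shows "real n * sqrt ((1 / q - 3 / (real n * x)) * (1 - (real n + 1)\<^sup>2 / E)) / (r - 1) / 2 \<le> kac_density n r"
proof -
  let ?a = "kac_a n r" and ?b = "kac_b n r" and ?c = "kac_c n r"
  have r0: "0 \<le> r" using r by simp
  have a: "?a > 0" using kac_a_ge(1)[OF r0, of n] by simp
  have n0: "real n > 0" using n by simp
  have "?a * (r - 1) \<le> r * r ^ n" using kac_a_rec[of r n] by (simp add: mult.commute)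
  then have ra: "r ^ n / ?a \<ge> (r - 1) / r" using a r by (simp add: field_simps)
  have "?c / ?a = ((real n + 1)\<^sup>2 * (r ^ n / ?a) - 2 * (r * ?b / ?a) - 1) / (r - 1)"
  proof -
    have "(r - 1) * ?c / ?a = (real n + 1)\<^sup>2 * (r ^ n / ?a) - 2 * (r * ?b / ?a) - 1"
      unfolding kac_c_rec using a by (simp add: field_simps)
    then show ?thesis using r by (simp add: field_simps)
  qed
  also have "\<dots> \<ge> ((real n + 1)\<^sup>2 * ((r - 1) / r) - 2 * real n - 1) / (r - 1)"
  proof (intro divide_right_mono diff_mono mult_left_mono ra)
    show "r * ?b / ?a \<le> real n" using kac_b_le[OF r0, of n] a by (simp add: divide_le_eq)
  qed (use r in auto)
  finally have "?c / ?a \<ge> ((real n + 1)\<^sup>2 * ((r - 1) / r) - 2 * real n - 1) / (r - 1)" by simp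
  moreover have "((real n + 1)\<^sup>2 * ((r - 1) / r) - 2 * real n - 1) / (r - 1) = (real n + 1)\<^sup>2 / r - (2 * real n + 1) / (r - 1)"
    using r by (simp add: field_simps)
  moreover have "(real n + 1)\<^sup>2 / r \<ge> (real n)\<^sup>2 / q" using r n0 by (intro frac_le) auto
  moreover have "(2 * real n + 1) / (r - 1) \<le> (3 * real n) / x" using r x n by (intro frac_le) auto
  moreover have "(real n)\<^sup>2 * (1 / q - 3 / (real n * x)) = (real n)\<^sup>2 / q - 3 * real n / x"
    using n0 by (simp add: field_simps power2_eq_square)
  ultimately have ca: "(real n)\<^sup>2 * (1 / q - 3 / (real n * x)) \<le> ?c / ?a" by linarith
  have "(real n + 1)\<^sup>2 * r ^ n / ?a\<^sup>2 \<le> (real n + 1)\<^sup>2 / E"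
  proof -
    have "r ^ n * E \<le> ?a * ?a" using E kac_a_ge(2)[OF r0, of n] a by (intro mult_mono) auto
    then have "r ^ n / ?a\<^sup>2 \<le> 1 / E" using a E by (simp add: field_simps power2_eq_square)
    then have "(real n + 1)\<^sup>2 * (r ^ n / ?a\<^sup>2) \<le> (real n + 1)\<^sup>2 * (1 / E)" by (intro mult_left_mono) auto
    then show ?thesis by simp
  qed
  moreover have "(?a * ?c - r * ?b\<^sup>2) / ?a\<^sup>2 = (1 - (real n + 1)\<^sup>2 * r ^ n / ?a\<^sup>2) / (r - 1)\<^sup>2"
  proof -
    have "(?a * ?c - r * ?b\<^sup>2) / ?a\<^sup>2 = (r - 1)\<^sup>2 * (?a * ?c - r * ?b\<^sup>2) / ?a\<^sup>2 / (r - 1)\<^sup>2"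
      using r by simp
    then show ?thesis unfolding kac_discriminant using a by (simp add: diff_divide_distrib)
  qed
  ultimately have da: "(1 - (real n + 1)\<^sup>2 / E) / (r - 1)\<^sup>2 \<le> (?a * ?c - r * ?b\<^sup>2) / ?a\<^sup>2"
    by (simp add: divide_right_mono)
  have "((real n)\<^sup>2 * (1 / q - 3 / (real n * x))) * ((1 - (real n + 1)\<^sup>2 / E) / (r - 1)\<^sup>2) \<le>
     (?c / ?a) * ((?a * ?c - r * ?b\<^sup>2) / ?a\<^sup>2)"
    using ca da pos a kac_c_nonneg[OF r0, of n] by (intro mult_mono) auto
  then have "sqrt ((real n / (r - 1))\<^sup>2 * ((1 / q - 3 / (real n * x)) * (1 - (real n + 1)\<^sup>2 / E))) \<le>
      sqrt ((?c / ?a) * ((?a * ?c - r * ?b\<^sup>2) / ?a\<^sup>2))"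
    by (simp add: power_divide mult_ac)
  moreover have "sqrt ((real n / (r - 1))\<^sup>2 * ((1 / q - 3 / (real n * x)) * (1 - (real n + 1)\<^sup>2 / E))) =
      real n * sqrt ((1 / q - 3 / (real n * x)) * (1 - (real n + 1)\<^sup>2 / E)) / (r - 1)"
    unfolding real_sqrt_mult[of "(real n / (r - 1))\<^sup>2"] real_sqrt_abs using r by simp
  ultimately show ?thesis unfolding kac_density_eq[OF r0] by (intro divide_right_mono) simp_all
qed

section \<open>Integration of the bounds over disk, exterior and annulus\<close>

lemma nn_integral_inverse_shift:
  fixes p q K :: real
  assumes "1 < p" "p \<le> q" "0 \<le> K"
  shows "(\<integral>\<^sup>+r. ennreal (K / (r - 1)) * indicator {p..q} r \<partial>lborel) = ennreal (K * (ln (q - 1) - ln (p - 1)))"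
proof -
  have "(\<integral>\<^sup>+r. ennreal (K / (r - 1)) * indicator {p..q} r \<partial>lborel) = ennreal (K * ln (q - 1) - K * ln (p - 1))"
    by (rule nn_integral_FTC_Icc[where F="\<lambda>r. K * ln (r - 1)"])
      (use assms in \<open>auto intro!: derivative_eq_intros simp: field_simps\<close>)
  then show ?thesis by (simp add: algebra_simps)
qed

lemma kac_density_le_outside':
  assumes "1 < r"
  shows "kac_density n r \<le> (real n / 2) / (r - 1)"
proof -
  have "kac_density n r \<le> real n / (sqrt r * (r - 1)) / 2" by (rule kac_density_le_outside[OF assms])
  also have "\<dots> \<le> real n / (1 * (r - 1)) / 2"
    using assms by (intro divide_right_mono divide_left_mono mult_right_mono) auto
  also have "\<dots> = (real n / 2) / (r - 1)" by (simp only: mult_1 divide_divide_eq_left mult.commute)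
  finally show ?thesis .
qed

text \<open>Three zones are separated at distance 1/n from r = 1, where the competing bounds have
  the same order n^2. The inner zone contributes n - 1, the middle one n^2 / 2 times its length 2/n,
  and the outer one the logarithm.\<close>

lemma expected_zeros_disk_le:
  fixes p :: real
  assumes n: "n \<ge> 1" and p: "1 + 1 / real n \<le> p"
  shows "expected_zeros n {z. (cmod z)\<^sup>2 \<le> p} \<le> ennreal (2 * real n + real n / 2 * (ln (p - 1) + ln (real n)))"
proof -
  have n0: "real n > 0" using n by simp
  have n1: "1 / real n \<le> 1" using n by simp
  have i1: "(\<integral>\<^sup>+r. ennreal (1 / (1 - r)\<^sup>2) * indicator {0..1 - 1 / real n} r \<partial>lborel) =
      ennreal (1 / (1 - (1 - 1 / real n)) - 1 / (1 - 0))"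
  proof (rule nn_integral_FTC_Icc[where F="\<lambda>r. 1 / (1 - r)"])
    fix r :: real assume "r \<in> {0..1 - 1 / real n}"
    moreover have "1 / real n > 0" using n0 by simp
    ultimately have "1 - r > 0" unfolding atLeastAtMost_iff by linarith
    then show "((\<lambda>r. 1 / (1 - r)) has_real_derivative 1 / (1 - r)\<^sup>2) (at r)"
      by (auto intro!: derivative_eq_intros simp: power2_eq_square)
  qed (use n1 in auto)
  have i2: "(\<integral>\<^sup>+r. ennreal ((real n)\<^sup>2 / 2) * indicator {1 - 1 / real n..1 + 1 / real n} r \<partial>lborel) = ennreal (real n)"
    using n0 by (subst nn_integral_cmult_indicator) (auto simp: power2_eq_square simp flip: ennreal_mult)
  have i3: "(\<integral>\<^sup>+r. ennreal ((real n / 2) / (r - 1)) * indicator {1 + 1 / real n..p} r \<partial>lborel) =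
      ennreal (real n / 2 * (ln (p - 1) + ln (real n)))"
    using n0 p by (subst nn_integral_inverse_shift) (auto simp: ln_div)
  have pn: "1 / real n \<le> p - 1" "0 < 1 / real n" using p n0 by simp_all
  then have "ln (1 / real n) \<le> ln (p - 1)"
    using ln_le_cancel_iff[of "1 / real n" "p - 1"] less_le_trans[OF pn(2,1)] by simp
  then have lnp: "ln (p - 1) + ln (real n) \<ge> 0" using n0 by (simp add: ln_div)
  have "expected_zeros n {z. (cmod z)\<^sup>2 \<le> p} = (\<integral>\<^sup>+r. ennreal (kac_density n r) * indicator ({..p} \<inter> {0..}) r \<partial>lborel)"
    using expected_zeros_radial[of "{..p}" n] by simp
  also have "\<dots> \<le> (\<integral>\<^sup>+r. ennreal (1 / (1 - r)\<^sup>2) * indicator {0..1 - 1 / real n} r +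
      (ennreal ((real n)\<^sup>2 / 2) * indicator {1 - 1 / real n..1 + 1 / real n} r +
       ennreal ((real n / 2) / (r - 1)) * indicator {1 + 1 / real n..p} r) \<partial>lborel)"
  proof (rule nn_integral_mono)
    fix r :: real
    have pos: "1 / real n > 0" using n0 by simp
    consider "r < 0 \<or> r > p" | "0 \<le> r" "r \<le> 1 - 1 / real n" | "0 \<le> r" "1 - 1 / real n < r" "r \<le> 1 + 1 / real n"
      | "1 + 1 / real n < r" "r \<le> p" by linarith
    then show "ennreal (kac_density n r) * indicator ({..p} \<inter> {0..}) r \<le> ennreal (1 / (1 - r)\<^sup>2) * indicator {0..1 - 1 / real n} r +
      (ennreal ((real n)\<^sup>2 / 2) * indicator {1 - 1 / real n..1 + 1 / real n} r +
       ennreal ((real n / 2) / (r - 1)) * indicator {1 + 1 / real n..p} r)"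
    proof cases
      case 1
      then show ?thesis by auto
    next
      case 2
      then have "kac_density n r \<le> 1 / (1 - r)\<^sup>2" using pos by (intro kac_density_le_inside) linarith+
      then have "ennreal (kac_density n r) * indicator ({..p} \<inter> {0..}) r \<le> ennreal (1 / (1 - r)\<^sup>2) * indicator {0..1 - 1 / real n} r"
        using 2 by (auto simp: indicator_def intro: ennreal_leI)
      then show ?thesis by (rule add_increasing2[rotated]) simp
    next
      case 3
      then have *: "ennreal (kac_density n r) * indicator ({..p} \<inter> {0..}) r \<le> ennreal ((real n)\<^sup>2 / 2) * indicator {1 - 1 / real n..1 + 1 / real n} r"
        using kac_density_le_square[of r n] by (auto simp: indicator_def intro: ennreal_leI)
      show ?thesis by (rule add_increasing[OF zero_le add_increasing2[OF zero_le *]])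
    next
      case 4
      then have r: "r > 1" using pos by linarith
      have "kac_density n r \<le> (real n / 2) / (r - 1)" by (rule kac_density_le_outside'[OF r])
      then have "ennreal (kac_density n r) * indicator ({..p} \<inter> {0..}) r \<le> ennreal ((real n / 2) / (r - 1)) * indicator {1 + 1 / real n..p} r"
        using 4 r by (auto simp: indicator_def intro: ennreal_leI)
      then show ?thesis by (intro add_increasing) auto
    qed
  qed
  also have "\<dots> = ennreal (1 / (1 - (1 - 1 / real n)) - 1 / (1 - 0)) + (ennreal (real n) + ennreal (real n / 2 * (ln (p - 1) + ln (real n))))"
    by (subst nn_integral_add, measurable, subst nn_integral_add, measurable) (simp only: i1 i2 i3)
  also have "\<dots> = ennreal (real n - 1 + (real n + real n / 2 * (ln (p - 1) + ln (real n))))"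
    using n lnp by (simp flip: ennreal_plus)
  also have "\<dots> \<le> ennreal (2 * real n + real n / 2 * (ln (p - 1) + ln (real n)))"
    by (intro ennreal_leI) simp
  finally show ?thesis .
qed

text \<open>Up to r = 2 the bound n / (2 (r - 1)) yields the logarithm. Beyond 2, r - 1 \<ge> r / 2
  turns the sharper bound into n r^(-3/2), with integral 2 n / sqrt 2.\<close>

lemma expected_zeros_exterior_le:
  fixes q :: real
  assumes q: "1 < q" "q \<le> 2"
  shows "expected_zeros n {z. (cmod z)\<^sup>2 \<ge> q} \<le> ennreal (2 * real n - real n / 2 * ln (q - 1))"
proof -
  have i1: "(\<integral>\<^sup>+r. ennreal ((real n / 2) / (r - 1)) * indicator {q..2} r \<partial>lborel) = ennreal (- (real n / 2 * ln (q - 1)))"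
    using q by (subst nn_integral_inverse_shift) auto
  have i2: "(\<integral>\<^sup>+r. ennreal (real n / (r * sqrt r)) * indicator {2..} r \<partial>lborel) = ennreal (0 - (- 2 * real n / sqrt 2))"
  proof (rule nn_integral_FTC_atLeast[where F="\<lambda>r. - 2 * real n / sqrt r"])
    show "((\<lambda>r::real. - 2 * real n / sqrt r) \<longlongrightarrow> 0) at_top" by real_asymp
    show "((\<lambda>r. - 2 * real n / sqrt r) has_real_derivative real n / (r * sqrt r)) (at r)" if "2 \<le> r" for r :: real
      using that by (auto intro!: derivative_eq_intros simp: field_simps)
  qed auto
  have "expected_zeros n {z. (cmod z)\<^sup>2 \<ge> q} = (\<integral>\<^sup>+r. ennreal (kac_density n r) * indicator ({q..} \<inter> {0..}) r \<partial>lborel)"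
    using expected_zeros_radial[of "{q..}" n] by simp
  also have "\<dots> \<le> (\<integral>\<^sup>+r. ennreal ((real n / 2) / (r - 1)) * indicator {q..2} r +
      ennreal (real n / (r * sqrt r)) * indicator {2..} r \<partial>lborel)"
  proof (rule nn_integral_mono)
    fix r :: real
    consider "r < q" | "q \<le> r" "r \<le> 2" | "2 < r" by linarith
    then show "ennreal (kac_density n r) * indicator ({q..} \<inter> {0..}) r \<le>
       ennreal ((real n / 2) / (r - 1)) * indicator {q..2} r + ennreal (real n / (r * sqrt r)) * indicator {2..} r"
    proof cases
      case 1
      then show ?thesis by auto
    next
      case 2
      then have "ennreal (kac_density n r) * indicator ({q..} \<inter> {0..}) r \<le> ennreal ((real n / 2) / (r - 1)) * indicator {q..2} r"
        using kac_density_le_outside'[of r n] q by (auto simp: indicator_def intro: ennreal_leI)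
      then show ?thesis by (rule add_increasing2[rotated]) simp
    next
      case 3
      have "kac_density n r \<le> real n / (sqrt r * (r - 1)) / 2" using 3 by (intro kac_density_le_outside) simp
      also have "\<dots> \<le> real n / (sqrt r * (r / 2)) / 2"
        using 3 by (intro divide_right_mono divide_left_mono mult_left_mono) auto
      also have "\<dots> = real n / (r * sqrt r)" by (simp add: mult.commute)
      finally have "ennreal (kac_density n r) * indicator ({q..} \<inter> {0..}) r \<le> ennreal (real n / (r * sqrt r)) * indicator {2..} r"
        using 3 q by (auto simp: indicator_def intro: ennreal_leI)
      then show ?thesis by (intro add_increasing) auto
    qed
  qed
  also have "\<dots> = ennreal (- (real n / 2 * ln (q - 1))) + ennreal (0 - (- 2 * real n / sqrt 2))"
    by (subst nn_integral_add) (measurable, simp only: i1 i2)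
  also have "\<dots> = ennreal (- (real n / 2 * ln (q - 1)) + 2 * real n / sqrt 2)"
    using q by (subst ennreal_plus[symmetric]) (auto simp: mult_nonneg_nonpos)
  also have "\<dots> \<le> ennreal (2 * real n - real n / 2 * ln (q - 1))"
  proof (rule ennreal_leI)
    have "2 * real n / sqrt 2 \<le> 2 * real n / 1" by (intro divide_left_mono) auto
    then show "- (real n / 2 * ln (q - 1)) + 2 * real n / sqrt 2 \<le> 2 * real n - real n / 2 * ln (q - 1)" by simp
  qed
  finally show ?thesis .
qed

lemma expected_zeros_annulus_le:
  fixes p q :: real
  assumes "1 < p" "p \<le> q"
  shows "expected_zeros n {z. p \<le> (cmod z)\<^sup>2 \<and> (cmod z)\<^sup>2 \<le> q} \<le> ennreal (real n / 2 * (ln (q - 1) - ln (p - 1)))"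
proof -
  have "expected_zeros n {z. p \<le> (cmod z)\<^sup>2 \<and> (cmod z)\<^sup>2 \<le> q} =
      (\<integral>\<^sup>+r. ennreal (kac_density n r) * indicator ({p..q} \<inter> {0..}) r \<partial>lborel)"
    using expected_zeros_radial[of "{p..q}" n] by simp
  also have "\<dots> \<le> (\<integral>\<^sup>+r. ennreal ((real n / 2) / (r - 1)) * indicator {p..q} r \<partial>lborel)"
    using assms kac_density_le_outside'[of _ n]
    by (intro nn_integral_mono) (auto simp: indicator_def intro!: ennreal_leI)
  also have "\<dots> = ennreal (real n / 2 * (ln (q - 1) - ln (p - 1)))"
    using assms by (intro nn_integral_inverse_shift) auto
  finally show ?thesis .
qed

text \<open>The value of \<open>E\<close> comes from ln(1 + x) \<ge> x - x^2 \<ge> x / 2 for x \<le>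
  1/2, so (1 + x)^n \<ge> exp(n x / 2). The factor \<open>sqrt \<theta>\<close> is the uniform loss
  against the upper bound n / (2 (r - 1)).\<close>

lemma expected_zeros_annulus_ge:
  fixes x q :: real
  assumes x: "0 < x" "1 + x \<le> q" "x \<le> 1 / 2" and n: "n \<ge> 1"
  defines "E \<equiv> exp (real n * x / 2)"
  defines "\<theta> \<equiv> (1 / q - 3 / (real n * x)) * (1 - (real n + 1)\<^sup>2 / E)"
  assumes pos: "0 \<le> 1 / q - 3 / (real n * x)" "0 \<le> 1 - (real n + 1)\<^sup>2 / E"
  shows "ennreal (real n / 2 * sqrt \<theta> * (ln (q - 1) - ln x)) \<le> expected_zeros n {z. 1 + x \<le> (cmod z)\<^sup>2 \<and> (cmod z)\<^sup>2 \<le> q}"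
proof -
  have E: "E \<le> r ^ n" if "1 + x \<le> r" for r
  proof -
    have "x * x \<le> x * (1 / 2)" using x by (intro mult_left_mono) auto
    then have "x / 2 \<le> x - x\<^sup>2" by (simp add: power2_eq_square)
    also have "\<dots> \<le> ln (1 + x)" using x by (intro ln_one_plus_pos_lower_bound) auto
    also have "\<dots> \<le> ln r" using x that by simp
    finally have "real n * (x / 2) \<le> real n * ln r" by (intro mult_left_mono) auto
    then have "E \<le> exp (real n * ln r)" by (simp add: E_def)
    also have "\<dots> = r ^ n" using that x by (simp add: exp_of_nat_mult)
    finally show ?thesis .
  qed
  have E0: "0 < E" by (simp add: E_def)
  have "ennreal (real n / 2 * sqrt \<theta> * (ln (q - 1) - ln (1 + x - 1))) =
      (\<integral>\<^sup>+r. ennreal ((real n / 2 * sqrt \<theta>) / (r - 1)) * indicator {1 + x..q} r \<partial>lborel)"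
    using x pos by (intro nn_integral_inverse_shift[symmetric]) (auto simp: \<theta>_def)
  also have "\<dots> \<le> (\<integral>\<^sup>+r. ennreal (kac_density n r) * indicator ({1 + x..q} \<inter> {0..}) r \<partial>lborel)"
  proof (rule nn_integral_mono)
    fix r :: real
    show "ennreal ((real n / 2 * sqrt \<theta>) / (r - 1)) * indicator {1 + x..q} r \<le> ennreal (kac_density n r) * indicator ({1 + x..q} \<inter> {0..}) r"
    proof (cases "1 + x \<le> r \<and> r \<le> q")
      case True
      then have "real n * sqrt \<theta> / (r - 1) / 2 \<le> kac_density n r"
        unfolding \<theta>_def using x n pos E[of r] E0 by (intro kac_density_ge_outside) auto
      then have "ennreal ((real n / 2 * sqrt \<theta>) / (r - 1)) \<le> ennreal (kac_density n r)"
        by (intro ennreal_leI) (simp add: mult_ac)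
      then show ?thesis using True x by (auto simp: indicator_def)
    qed auto
  qed
  also have "\<dots> = expected_zeros n {z. 1 + x \<le> (cmod z)\<^sup>2 \<and> (cmod z)\<^sup>2 \<le> q}"
    using expected_zeros_radial[of "{1 + x..q}" n] by simp
  finally show ?thesis by simp
qed

text \<open>The two O-bounds are stated in \<open>ennreal\<close> and so include finiteness. For the
  annulus finiteness is a separate clause, since \<open>enn2real\<close> sends infinity to 0 and the
  equivalence alone would not exclude it.\<close>

theorem theorem1p4:
  shows "(\<exists>C N. \<forall>n\<ge>N. expected_zeros n {z. (cmod z)\<^sup>2 \<le> 1 + (ln (real n))\<^sup>2 / real n}
            \<le> ennreal (C * real n * ln (ln (real n))))
       \<and> (\<forall>\<^sub>F n in at_top. expected_zeros n
              {z. 1 + (ln (real n))\<^sup>2 / real n \<le> (cmod z)\<^sup>2 \<and> (cmod z)\<^sup>2 \<le> 1 + 1 / ln (real n)} < \<infinity>)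
       \<and> ((\<lambda>n. enn2real (expected_zeros n
              {z. 1 + (ln (real n))\<^sup>2 / real n \<le> (cmod z)\<^sup>2 \<and> (cmod z)\<^sup>2 \<le> 1 + 1 / ln (real n)}))
            \<sim>[at_top] (\<lambda>n. 1 / 2 * real n * ln (real n)))
       \<and> (\<exists>C N. \<forall>n\<ge>N. expected_zeros n {z. (cmod z)\<^sup>2 \<ge> 1 + 1 / ln (real n)}
            \<le> ennreal (C * real n * ln (ln (real n))))"
    (is "?disk \<and> ?fin \<and> ?asymp \<and> ?ext")
proof -
  let ?E = "\<lambda>n. expected_zeros n
    {z. 1 + (ln (real n))\<^sup>2 / real n \<le> (cmod z)\<^sup>2 \<and> (cmod z)\<^sup>2 \<le> 1 + 1 / ln (real n)}"
  have ev_ll: "\<forall>\<^sub>F n in at_top. 1 \<le> ln (ln (real n))" by real_asymp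
  have ev_L: "\<forall>\<^sub>F n in at_top. 1 \<le> ln (real n)" by real_asymp
  have ev_1: "\<forall>\<^sub>F n::nat in at_top. n \<ge> 1" by (rule eventually_ge_at_top)
  have ev_x: "\<forall>\<^sub>F n in at_top. (ln (real n))\<^sup>2 / real n \<le> 1 / ln (real n)" by real_asymp
  have ev_h: "\<forall>\<^sub>F n in at_top. (ln (real n))\<^sup>2 / real n \<le> 1 / 2" by real_asymp

  have "\<forall>\<^sub>F n in at_top. expected_zeros n {z. (cmod z)\<^sup>2 \<le> 1 + (ln (real n))\<^sup>2 / real n}
            \<le> ennreal (3 * real n * ln (ln (real n)))"
    using ev_ll ev_L ev_1
  proof eventually_elim
    case (elim n)
    let ?L = "ln (real n)"
    have n0: "real n > 0" using elim by simp
    have "1 \<le> ?L\<^sup>2" using elim(2) by simp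
    then have "expected_zeros n {z. (cmod z)\<^sup>2 \<le> 1 + ?L\<^sup>2 / real n} \<le>
        ennreal (2 * real n + real n / 2 * (ln (1 + ?L\<^sup>2 / real n - 1) + ln (real n)))"
      using n0 elim(3) by (intro expected_zeros_disk_le) (auto simp: divide_right_mono)
    also have "ln (1 + ?L\<^sup>2 / real n - 1) + ln (real n) = 2 * ln ?L"
      using n0 elim(2) by (simp add: ln_div ln_realpow)
    \<comment> \<open>The constant 3 absorbs the linear term: eventually ln (ln n) \<ge> 1, so 2 n
      is at most 2 n ln (ln n).\<close>
    also have "ennreal (2 * real n + real n / 2 * (2 * ln ?L)) \<le> ennreal (3 * real n * ln ?L)"
    proof (rule ennreal_leI)
      have "2 * real n * 1 \<le> 2 * real n * ln ?L" using elim(1) by (intro mult_left_mono) auto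
      then show "2 * real n + real n / 2 * (2 * ln ?L) \<le> 3 * real n * ln ?L" by simp
    qed
    finally show ?case .
  qed
  then have disk: ?disk unfolding eventually_sequentially by blast

  have "\<forall>\<^sub>F n in at_top. expected_zeros n {z. (cmod z)\<^sup>2 \<ge> 1 + 1 / ln (real n)}
            \<le> ennreal (3 * real n * ln (ln (real n)))"
    using ev_ll ev_L
  proof eventually_elim
    case (elim n)
    let ?L = "ln (real n)"
    have "expected_zeros n {z. (cmod z)\<^sup>2 \<ge> 1 + 1 / ?L} \<le> ennreal (2 * real n - real n / 2 * ln (1 + 1 / ?L - 1))"
      using elim(2) by (intro expected_zeros_exterior_le) auto
    also have "\<dots> \<le> ennreal (3 * real n * ln ?L)"
    proof (rule ennreal_leI)
      have "2 * real n * 1 \<le> 2 * real n * ln ?L" using elim(1) by (intro mult_left_mono) auto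
      moreover have "real n / 2 * ln ?L \<le> real n * ln ?L" using elim(1) by (intro mult_right_mono) auto
      moreover have "ln (1 + 1 / ?L - 1) = - ln ?L" using elim(2) by (simp add: ln_div)
      ultimately show "2 * real n - real n / 2 * ln (1 + 1 / ?L - 1) \<le> 3 * real n * ln ?L" by simp
    qed
    finally show ?case .
  qed
  then have ext: ?ext unfolding eventually_sequentially by blast

  \<comment> \<open>This is the logarithmic length of the annulus. Both cut-offs cost only multiples
    of ln (ln n), so the main term is ln n.\<close>
  have len: "ln (1 + 1 / ln (real n) - 1) - ln ((ln (real n))\<^sup>2 / real n) = ln (real n) - 3 * ln (ln (real n))"
    if "1 \<le> ln (real n)" "n \<ge> 1" for n :: nat
    using that by (simp add: ln_div ln_realpow)
  have up: "\<forall>\<^sub>F n in at_top. ?E n \<le> ennreal (real n / 2 * (ln (real n) - 3 * ln (ln (real n))))"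
    using ev_L ev_1 ev_x
  proof eventually_elim
    case (elim n)
    have "0 < (ln (real n))\<^sup>2 / real n" using elim by (intro divide_pos_pos) auto
    then show ?case
      using expected_zeros_annulus_le[of "1 + (ln (real n))\<^sup>2 / real n" "1 + 1 / ln (real n)" n] elim len[of n] by simp
  qed
  then have fin: ?fin by eventually_elim (simp add: le_less_trans)

  \<comment> \<open>With x = (ln n)^2 / n the product n x is (ln n)^2 and \<open>E\<close> becomes
    exp((ln n)^2 / 2), which outgrows (n + 1)^2. Both factors tend to 1.\<close>
  define \<theta> where "\<theta> n = (1 / (1 + 1 / ln (real n)) - 3 / (ln (real n))\<^sup>2) *
    (1 - (real n + 1)\<^sup>2 / exp ((ln (real n))\<^sup>2 / 2))" for n
  have ev_p1: "\<forall>\<^sub>F n in at_top. 0 \<le> 1 / (1 + 1 / ln (real n)) - 3 / (ln (real n))\<^sup>2" by real_asymp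
  have ev_p2: "\<forall>\<^sub>F n in at_top. 0 \<le> 1 - (real n + 1)\<^sup>2 / exp ((ln (real n))\<^sup>2 / 2)" by real_asymp
  have low: "\<forall>\<^sub>F n in at_top. ennreal (real n / 2 * sqrt (\<theta> n) * (ln (real n) - 3 * ln (ln (real n)))) \<le> ?E n"
    using ev_L ev_1 ev_x ev_h ev_p1 ev_p2
  proof eventually_elim
    case (elim n)
    have n0: "real n \<noteq> 0" using elim by simp
    have "0 < (ln (real n))\<^sup>2 / real n" using elim by (intro divide_pos_pos) auto
    then show ?case
      using expected_zeros_annulus_ge[of "(ln (real n))\<^sup>2 / real n" "1 + 1 / ln (real n)" n] elim len[of n] n0
      by (simp add: \<theta>_def)
  qed
  have asymp: ?asymp
  proof (rule asymp_equivI', rule tendsto_sandwich)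
    show "\<forall>\<^sub>F n in at_top. sqrt (\<theta> n) * (1 - 3 * ln (ln (real n)) / ln (real n)) \<le>
        enn2real (?E n) / (1 / 2 * real n * ln (real n))"
      using low fin ev_L ev_1
    proof eventually_elim
      case (elim n)
      have "real n / 2 * sqrt (\<theta> n) * (ln (real n) - 3 * ln (ln (real n))) \<le> enn2real (?E n)"
        (is "?X \<le> _")
      proof -
        \<comment> \<open>Negative reals are truncated to 0 by \<open>ennreal\<close>, so the
          inequality holds for either sign and the sign of the lower bound need not be
          known.\<close>
        have "y \<le> enn2real (ennreal y)" for y by (cases "0 \<le> y") (auto simp: ennreal_neg)
        then have "?X \<le> enn2real (ennreal ?X)" .
        also have "\<dots> \<le> enn2real (?E n)" using elim(1,2) by (intro enn2real_mono) auto
        finally show ?thesis .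
      qed
      then have "real n / 2 * sqrt (\<theta> n) * (ln (real n) - 3 * ln (ln (real n))) / (1 / 2 * real n * ln (real n)) \<le>
          enn2real (?E n) / (1 / 2 * real n * ln (real n))"
        using elim(3) by (intro divide_right_mono) auto
      also have "real n / 2 * sqrt (\<theta> n) * (ln (real n) - 3 * ln (ln (real n))) / (1 / 2 * real n * ln (real n)) =
          sqrt (\<theta> n) * (1 - 3 * ln (ln (real n)) / ln (real n))"
      proof -
        have "ln (real n) \<noteq> 0" "real n \<noteq> 0" using elim(3,4) by auto
        then show ?thesis by (simp add: field_simps)
      qed
      finally show ?case .
    qed
    show "\<forall>\<^sub>F n in at_top. enn2real (?E n) / (1 / 2 * real n * ln (real n)) \<le> 1"
      using up ev_ll ev_L ev_1
    proof eventually_elim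
      case (elim n)
      have "?E n \<le> ennreal (real n / 2 * ln (real n))"
        using elim by (intro order_trans[OF elim(1)] ennreal_leI mult_left_mono) auto
      then have "enn2real (?E n) \<le> real n / 2 * ln (real n)" using elim(3) by (intro enn2real_leI) auto
      moreover have "0 < 1 / 2 * real n * ln (real n)"
      proof (rule mult_pos_pos)
        show "0 < ln (real n)" using elim(3) by linarith
      qed (use elim(4) in simp)
      ultimately show ?case by (subst pos_divide_le_eq) auto
    qed
    show "(\<lambda>n. sqrt (\<theta> n) * (1 - 3 * ln (ln (real n)) / ln (real n))) \<longlonglongrightarrow> 1"
      unfolding \<theta>_def by real_asymp
  qed simp
  show ?thesis using disk fin asymp ext by blast
qed

end
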